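(* For any integer $M\geq 1$ there exists an explicit set of $N=4M^2+2$ points on $\mathbb{S}^2$ depending on random parameters, namely the random configuration $\Omega_M$ constructed in the context with random phases $\theta_1,\dots,\theta_{2M-1}$, whose expected $2$-energy satisfies, as $M\to\infty$ (equivalently $N=4M^2+2\to\infty$), $$\mathbb{E}_{\theta_1,\dots,\theta_{2M-1}}\bigl[E_2(\Omega_M)\bigr]=\frac14 N^2\log N+C_{\diamond,2}N^2+o(N^2),$$ where $$C_{\diamond,2}=\frac12\Bigl(\gamma-\frac12-\frac{\log 2}{3}\Bigr)=-0.0769\ldots$$ and $\gamma$ is the Euler--Mascheroni constant.
   Context: $\mathbb{S}^2\subset\mathbb{R}^3$ is the unit sphere. For a finite set $\omega_N=\{x_1,\dots,x_N\}\subset\mathbb{S}^2$ of $N$ points, the Riesz $2$-energy is $E_2(\omega_N)=\sum_{i\neq j}\|x_i-x_j\|^{-2}$, the sum running over ordered pairs of distinct indices and $\|\cdot\|$ being the Euclidean norm in $\mathbb{R}^3$. Construction of $\Omega_M$ (Diamond ensemble with $r_j=4j$): for an integer $M\ge 1$, put $r_j=4j$ for $1\le j\le M$ and $r_j=r_{2M-j}$ for $M<j\le 2M-1$; put $z_j=\frac{4M^2-4j^2}{1+4M^2}$ for $1\le j\le M$ and $z_j=-z_{2M-j}$ for $M<j\le 2M-1$. Let $\theta_1,\dots,\theta_{2M-1}$ be independent and uniformly distributed in $[0,2\pi]$. Then $\Omega_M$ consists of the poles $(0,0,1)$ and $(0,0,-1)$ together with the points $$x_j^{\ell}=\Bigl(\sqrt{1-z_j^2}\cos\bigl(\tfrac{2\pi\ell}{r_j}+\theta_j\bigr),\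 \sqrt{1-z_j^2}\sin\bigl(\tfrac{2\pi\ell}{r_j}+\theta_j\bigr),\ z_j\Bigr),\qquad 1\le j\le 2M-1,\ 1\le \ell\le r_j.$$ The total number of points is $N=2+\sum_{j=1}^{2M-1}r_j=4M^2+2$. *)

theory Defs
  imports "HOL-Probability.Probability" "HOL-Library.Landau_Symbols"
begin

text \<open>The sum runs over ordered pairs of distinct points of the (finite) set.\<close>

definition riesz_2_energy :: "(real ^ 3) set \<Rightarrow> real" where
  "riesz_2_energy A = (\<Sum>(x, y) \<in> {(x, y). x \<in> A \<and> y \<in> A \<and> x \<noteq> y}. 1 / (norm (x - y))\<^sup>2)"

text \<open>
  The parallels of the Diamond ensemble are indexed by \<open>1 \<le> j \<le> 2 * M - 1\<close>;
  the values of the next two functions outside this range are irrelevant.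
\<close>

definition diamond_r :: "nat \<Rightarrow> nat \<Rightarrow> nat" where
  "diamond_r M j = (if j \<le> M then 4 * j else 4 * (2 * M - j))"

definition diamond_z :: "nat \<Rightarrow> nat \<Rightarrow> real" where
  "diamond_z M j =
     (if j \<le> M then (4 * real M ^ 2 - 4 * real j ^ 2) / (1 + 4 * real M ^ 2)
      else - ((4 * real M ^ 2 - 4 * real (2 * M - j) ^ 2) / (1 + 4 * real M ^ 2)))"

definition diamond_point :: "nat \<Rightarrow> (nat \<Rightarrow> real) \<Rightarrow> nat \<Rightarrow> nat \<Rightarrow> real ^ 3" where
  "diamond_point M \<theta> j l =
     vector [sqrt (1 - (diamond_z M j)\<^sup>2) * cos (2 * pi * real l / real (diamond_r M j) + \<theta> j),
             sqrt (1 - (diamond_z M j)\<^sup>2) * sin (2 * pi * real l / real (diamond_r M j) + \<theta> j),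
             diamond_z M j]"

definition diamond_ensemble :: "nat \<Rightarrow> (nat \<Rightarrow> real) \<Rightarrow> (real ^ 3) set" where
  "diamond_ensemble M \<theta> =
     {vector [0, 0, 1], vector [0, 0, - 1]} \<union>
     {diamond_point M \<theta> j l | j l. j \<in> {1..2 * M - 1} \<and> l \<in> {1..diamond_r M j}}"

definition diamond_N :: "nat \<Rightarrow> nat" where
  "diamond_N M = 4 * M ^ 2 + 2"

definition diamond_const :: real where
  "diamond_const = 1 / 2 * (euler_mascheroni - 1 / 2 - ln 2 / 3)"

end

theory Submission
  imports Defs "HOL-Real_Asymp.Real_Asymp"
begin

text \<open>
  Two points at the heights \<open>h\<close> and \<open>k\<close> whose longitudes differ by a uniformly distributed angle \<open>\<phi>\<close> have squared
  distance \<open>a - b * cos \<phi>\<close> with \<open>a = 2 - 2 * h * k\<close> and \<open>b = 2 * sqrt (1 - h\<^sup>2) * sqrt (1 - k\<^sup>2)\<close>. The mean of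
  \<open>1 / (a - b * cos \<phi>)\<close> is \<open>1 / sqrt (a\<^sup>2 - b\<^sup>2)\<close>, and on the unit sphere \<open>a\<^sup>2 - b\<^sup>2 = 4 * (h - k)\<^sup>2\<close>. Hence a point of one
  parallel and a point of another one have the mean interaction \<open>1 / (2 * \<bar>h - k\<bar>)\<close>
  (\<open>expected_ring_pair_interaction\<close>), while the energy within a parallel of \<open>r\<close> equally spaced points is the
  deterministic number \<open>r * (r\<^sup>2 - 1) / (12 * (1 - h\<^sup>2))\<close> (\<open>same_ring_energy\<close>), by
  \<open>(\<Sum>k=1..<r. 1 / (sin (pi * k / r))\<^sup>2) = (r\<^sup>2 - 1) / 3\<close>. The poles behave like parallels with one point.

  For the heights of the Diamond ensemble, \<open>\<bar>h - k\<bar>\<close> is \<open>4 * \<bar>i\<^sup>2 - j\<^sup>2\<bar> / (1 + 4 * M\<^sup>2)\<close> for parallels on the same side of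
  the equator and \<open>4 * (2 * M\<^sup>2 - i\<^sup>2 - j\<^sup>2) / (1 + 4 * M\<^sup>2)\<close> on opposite sides. So the expected energy is an explicit
  rational sum (\<open>sum_all_ring_pairs\<close>), whose parts have the following sizes relative to \<open>N\<^sup>2\<close>.

  \<^item> Same side: partial fractions turn the inner sums into harmonic numbers, and the contribution is
    \<open>ln M / 2 - 1 / 4 + (euler_mascheroni - ln 2) / 2\<close> (\<open>same_side_sum_asymp\<close>).
  \<^item> Opposite sides: a monotone Riemann sum with limit \<open>ln 2 / 2\<close> (\<open>opposite_side_sum_asymp\<close>).
  \<^item> Within the parallels: a monotone Riemann sum with limit \<open>ln 2 / 3\<close> (\<open>parallel_self_energy_asymp\<close>).
  \<^item> Pairs that involve a pole: negligible (\<open>pole_parallel_energy_asymp\<close>).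

  Since \<open>ln M / 2 = ln N / 4 - ln 2 / 2 + o(1)\<close>, these add up to \<open>ln N / 4 + diamond_const\<close>.
\<close>

section \<open>Averages over uniform phases\<close>

lemma a_minus_b_cos_pos:
  fixes a b :: real
  assumes "\<bar>b\<bar> < a"
  shows "a - b * cos x > 0"
proof -
  have "\<bar>b * cos x\<bar> \<le> \<bar>b\<bar> * 1"
    unfolding abs_mult by (intro mult_left_mono) auto
  then show ?thesis using assms by linarith
qed

text \<open>
  With \<open>s = sqrt (a\<^sup>2 - b\<^sup>2)\<close> and \<open>\<beta> = b / (a + s)\<close>, the quotient \<open>s / (a - b * cos x)\<close> is the
  Poisson kernel \<open>1 + 2 * (\<Sum>k\<ge>1. \<beta> ^ k * cos (k * x))\<close>. Integrating termwise gives
  \<open>x + 2 * arctan (\<beta> * sin x / (1 - \<beta> * cos x))\<close>. In contrast to the primitive found with the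
  substitution \<open>tan (x / 2)\<close>, this one is smooth on the whole line, so it can be evaluated over a
  full period starting anywhere.
\<close>
lemma DERIV_inverse_a_minus_b_cos:
  fixes a b :: real
  assumes ab: "\<bar>b\<bar> < a"
  defines "s \<equiv> sqrt (a\<^sup>2 - b\<^sup>2)"
  shows "((\<lambda>x. x / s + 2 / s * arctan (b * sin x / (a + s - b * cos x)))
            has_real_derivative 1 / (a - b * cos x)) (at x)"
proof -
  have "b\<^sup>2 < a\<^sup>2" using ab by (metis abs_ge_zero power2_abs power_strict_mono zero_less_numeral)
  then have s: "s > 0" and ss: "s * s = a\<^sup>2 - b\<^sup>2" by (auto simp: s_def)
  have a: "a > 0" using ab by linarith
  define v where "v = a + s - b * cos x"
  define w where "w = a - b * cos x"
  have w: "w > 0" using a_minus_b_cos_pos[OF ab] by (simp add: w_def)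
  have v: "v > 0" using w s by (simp add: v_def w_def)
  have num: "b * cos x * v - b * sin x * (b * sin x) = (a + s) * (s - w)"
  proof -
    have "b * cos x * v - b * sin x * (b * sin x) = (a + s) * (b * cos x) - b\<^sup>2 * ((cos x)\<^sup>2 + (sin x)\<^sup>2)"
      unfolding v_def by algebra
    also have "\<dots> = (a + s) * (b * cos x) - b\<^sup>2" by simp
    also have "\<dots> = (a + s) * (s - w)"
      using ss by (simp add: w_def algebra_simps power2_eq_square)
    finally show ?thesis .
  qed
  have den: "v\<^sup>2 + (b * sin x)\<^sup>2 = (a + s) * (2 * w)"
  proof -
    have "v\<^sup>2 + (b * sin x)\<^sup>2 = (a + s)\<^sup>2 - 2 * (a + s) * (b * cos x) + b\<^sup>2 * ((cos x)\<^sup>2 + (sin x)\<^sup>2)"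
      unfolding v_def by algebra
    also have "\<dots> = (a + s)\<^sup>2 - 2 * (a + s) * (b * cos x) + b\<^sup>2" by simp
    also have "\<dots> = (a + s) * (2 * w)"
      using ss by (simp add: w_def algebra_simps power2_eq_square)
    finally show ?thesis .
  qed
  have "((\<lambda>x. b * sin x / (a + s - b * cos x)) has_real_derivative
      (b * cos x * v - b * sin x * (b * sin x)) / (v * v)) (at x)"
    using v by (auto intro!: derivative_eq_intros simp: v_def)
  then have "((\<lambda>x. x / s + 2 / s * arctan (b * sin x / (a + s - b * cos x)))
      has_real_derivative 1 / s + 2 / s * (inverse (1 + (b * sin x / v)\<^sup>2) *
        ((b * cos x * v - b * sin x * (b * sin x)) / (v * v)))) (at x)"
    unfolding v_def
    by (intro DERIV_add DERIV_cdivide DERIV_ident DERIV_cmult DERIV_chain2[OF DERIV_arctan])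
  also have "inverse (1 + (b * sin x / v)\<^sup>2) * ((b * cos x * v - b * sin x * (b * sin x)) / (v * v))
      = (b * cos x * v - b * sin x * (b * sin x)) / (v\<^sup>2 + (b * sin x)\<^sup>2)"
  proof -
    have "1 + (b * sin x / v)\<^sup>2 = (v\<^sup>2 + (b * sin x)\<^sup>2) / (v * v)"
      using v by (simp add: field_simps power2_eq_square)
    then show ?thesis using v by simp
  qed
  also have "\<dots> = (s - w) / (2 * w)"
    unfolding num den using a s by simp
  also have "1 / s + 2 / s * ((s - w) / (2 * w)) = 1 / w"
    using s w by (simp add: field_simps)
  finally show ?thesis by (simp add: w_def)
qed

text \<open>
  The \<open>arctan\<close> part of the primitive is periodic and cancels; only the linear part contributes.
  The value does not depend on the shift \<open>c\<close>, which is what makes a second independent phase harmless.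
\<close>
lemma integral_inverse_a_minus_b_cos:
  fixes a b c :: real
  assumes ab: "\<bar>b\<bar> < a"
  shows "(\<integral>x. 1 / (a - b * cos (c + x)) * indicator {0..2 * pi} x \<partial>lborel)
           = 2 * pi / sqrt (a\<^sup>2 - b\<^sup>2)"
proof -
  define F where "F x = x / sqrt (a\<^sup>2 - b\<^sup>2) + 2 / sqrt (a\<^sup>2 - b\<^sup>2) *
      arctan (b * sin x / (a + sqrt (a\<^sup>2 - b\<^sup>2) - b * cos x))" for x
  have D: "((\<lambda>x. F (c + x)) has_real_derivative 1 / (a - b * cos (c + x))) (at x)" for x
    using DERIV_inverse_a_minus_b_cos[OF ab, of "x + c"]
    unfolding F_def [abs_def, symmetric] by (simp add: DERIV_shift [symmetric] add.commute[of c])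
  have pos: "a - b * cos x \<noteq> 0" for x
    using a_minus_b_cos_pos[OF ab, of x] by linarith
  have "(\<integral>x. 1 / (a - b * cos (c + x)) * indicator {0..2 * pi} x \<partial>lborel) = F (c + 2 * pi) - F (c + 0)"
    by (rule integral_FTC_Icc_real, simp, rule D) (intro continuous_intros pos)
  also have "\<dots> = 2 * pi / sqrt (a\<^sup>2 - b\<^sup>2)"
    by (simp add: F_def add_divide_distrib)
  finally show ?thesis .
qed

lemma integral_uniform_measure_lborel_Icc:
  fixes f :: "real \<Rightarrow> real"
  assumes f[measurable]: "f \<in> borel_measurable borel" and ab: "a < b"
  shows "(\<integral>x. f x \<partial>uniform_measure lborel {a..b})
           = (\<integral>x. f x * indicator {a..b} x \<partial>lborel) / (b - a)"
proof -
  have "uniform_measure lborel {a..b} = density lborel (\<lambda>x. ennreal (indicator {a..b} x / (b - a)))"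
    unfolding uniform_measure_def using ab
    by (intro density_cong) (auto simp: divide_ennreal[symmetric] split: split_indicator intro!: AE_I2)
  then have "(\<integral>x. f x \<partial>uniform_measure lborel {a..b})
      = (\<integral>x. (indicator {a..b} x / (b - a)) *\<^sub>R f x \<partial>lborel)"
    using ab by (simp only:) (subst integral_density, auto)
  also have "\<dots> = (\<integral>x. (f x * indicator {a..b} x) / (b - a) \<partial>lborel)"
    by (intro Bochner_Integration.integral_cong) auto
  finally show ?thesis by simp
qed

lemma (in prob_space) indep_vars_imp_indep_var:
  assumes "indep_vars M' X I" "i \<in> I" "j \<in> I" "i \<noteq> j"
  shows "indep_var (M' i) (X i) (M' j) (X j)"
proof -
  have "indep_var (PiM {i} M') (\<lambda>\<omega>. restrict (\<lambda>k. X k \<omega>) {i})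
                  (PiM {j} M') (\<lambda>\<omega>. restrict (\<lambda>k. X k \<omega>) {j})"
    using assms by (intro indep_var_restrict[where I = I]) auto
  then have "indep_var (M' i) ((\<lambda>f. f i) \<circ> (\<lambda>\<omega>. restrict (\<lambda>k. X k \<omega>) {i}))
                       (M' j) ((\<lambda>f. f j) \<circ> (\<lambda>\<omega>. restrict (\<lambda>k. X k \<omega>) {j}))"
    by (rule indep_var_compose) auto
  then show ?thesis by (simp add: comp_def)
qed

text \<open>
  By independence the joint law is a product, so Fubini applies, and the inner integral over
  the phase \<open>X\<close> is already constant in the value of \<open>Y\<close>.
\<close>
lemma (in prob_space) expectation_inverse_cos_uniform_phases:
  fixes X Y :: "'a \<Rightarrow> real"
  assumes ind: "indep_var borel X borel Y"
    and dX: "distr M borel X = uniform_measure lborel {0..2 * pi}"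
    and dY: "distr M borel Y = uniform_measure lborel {0..2 * pi}"
    and ab: "\<bar>b\<bar> < a"
  shows "integrable M (\<lambda>\<omega>. 1 / (a - b * cos (c + X \<omega> - Y \<omega>)))"
    and "expectation (\<lambda>\<omega>. 1 / (a - b * cos (c + X \<omega> - Y \<omega>))) = 1 / sqrt (a\<^sup>2 - b\<^sup>2)"
proof -
  define U where "U = uniform_measure lborel {0..2 * pi}"
  interpret U: prob_space U
    unfolding U_def by (rule prob_space_uniform_measure) auto
  interpret UU: pair_prob_space U U ..
  have sU [measurable_cong]: "sets U = sets borel" by (simp add: U_def)
  have rv [measurable]: "X \<in> borel_measurable M" "Y \<in> borel_measurable M"
    using indep_var_rv1[OF ind] indep_var_rv2[OF ind] by auto
  have joint: "U \<Otimes>\<^sub>M U = distr M (borel \<Otimes>\<^sub>M borel) (\<lambda>\<omega>. (X \<omega>, Y \<omega>))"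
    using ind dX dY by (simp add: indep_var_distribution_eq U_def)
  define g where "g x y = 1 / (a - b * cos (c + x - y))" for x y
  have [measurable]: "case_prod g \<in> borel_measurable (borel \<Otimes>\<^sub>M borel)"
    unfolding g_def by measurable
  have bound: "\<bar>g x y\<bar> \<le> 1 / (a - \<bar>b\<bar>)" for x y
  proof -
    have "\<bar>b * cos (c + x - y)\<bar> \<le> \<bar>b\<bar> * 1"
      unfolding abs_mult by (intro mult_left_mono) auto
    then have "a - \<bar>b\<bar> \<le> a - b * cos (c + x - y)" by linarith
    then show ?thesis using ab by (auto simp: g_def abs_mult intro!: divide_left_mono mult_pos_pos)
  qed
  show "integrable M (\<lambda>\<omega>. 1 / (a - b * cos (c + X \<omega> - Y \<omega>)))"
    using bound by (intro integrable_const_bound[where B = "1 / (a - \<bar>b\<bar>)"]) (auto simp: g_def)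
  have int: "integrable (U \<Otimes>\<^sub>M U) (case_prod g)"
    using bound by (intro UU.P.integrable_const_bound[where B = "1 / (a - \<bar>b\<bar>)"]) auto
  have inner: "(\<integral>x. g x y \<partial>U) = 1 / sqrt (a\<^sup>2 - b\<^sup>2)" for y
  proof -
    have "(\<integral>x. g x y \<partial>U) = (\<integral>x. 1 / (a - b * cos ((c - y) + x)) * indicator {0..2 * pi} x \<partial>lborel) / (2 * pi)"
      unfolding U_def g_def
      by (subst integral_uniform_measure_lborel_Icc) (auto simp: algebra_simps)
    then show ?thesis by (simp only: integral_inverse_a_minus_b_cos[OF ab]) simp
  qed
  have "expectation (\<lambda>\<omega>. g (X \<omega>) (Y \<omega>)) = (\<integral>z. case_prod g z \<partial>(U \<Otimes>\<^sub>M U))"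
    unfolding joint by (subst integral_distr) auto
  also have "\<dots> = (\<integral>y. (\<integral>x. g x y \<partial>U) \<partial>U)"
    by (rule UU.integral_snd[OF int, symmetric])
  also have "\<dots> = 1 / sqrt (a\<^sup>2 - b\<^sup>2)"
    by (simp add: inner U.prob_space)
  finally show "expectation (\<lambda>\<omega>. 1 / (a - b * cos (c + X \<omega> - Y \<omega>))) = 1 / sqrt (a\<^sup>2 - b\<^sup>2)"
    by (simp add: g_def)
qed

section \<open>Energy of a regular polygon\<close>

lemma sum_cos_roots_of_unity:
  assumes r: "r > 0" and "\<not> int r dvd m"
  shows "(\<Sum>k<r. cos (2 * pi * real_of_int m * real k / real r)) = 0"
proof -
  define z where "z = cis (2 * pi * real_of_int m / real r)"
  have "z \<noteq> 1"
  proof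
    assume "z = 1"
    then have "cos (2 * pi * real_of_int m / real r) = 1"
      by (metis z_def cis.sel(1) one_complex.sel(1))
    then obtain n :: int where "2 * pi * real_of_int m / real r = of_int n * 2 * pi"
      by (auto simp: cos_one_2pi_int)
    then have "real_of_int m = real_of_int (n * int r)" using r by (simp add: field_simps)
    then have "m = n * int r" by linarith
    with assms show False by simp
  qed
  have "z ^ r = 1"
  proof -
    have "z ^ r = cis (2 * pi * real_of_int m)"
      using r by (simp add: z_def Complex.DeMoivre)
    then show ?thesis by (simp add: cis_multiple_2pi)
  qed
  then have "(\<Sum>k<r. z ^ k) = 0"
    using \<open>z \<noteq> 1\<close> by (simp add: geometric_sum)
  then have "Re (\<Sum>k<r. z ^ k) = 0" by simp
  then show ?thesis by (simp only: z_def Re_sum cis.sel Complex.DeMoivre) (simp add: mult_ac)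
qed

text \<open>
  The left-hand side, as a function of \<open>m\<close>, vanishes at \<open>0\<close>, is \<open>r - 1\<close> at \<open>1\<close>, and has constant second
  difference \<open>-2\<close>: the second difference of \<open>(sin (m * t))\<^sup>2\<close> in \<open>m\<close> is \<open>2 * cos (2 * m * t) * (sin t)\<^sup>2\<close>, whose factor
  \<open>(sin t)\<^sup>2\<close> cancels the denominator and leaves a sum over nontrivial roots of unity.
\<close>
lemma sum_sin_squares_ratio:
  assumes "r \<ge> 1" "m \<le> r"
  shows "(\<Sum>k=1..<r. (sin (pi * real m * real k / real r))\<^sup>2 / (sin (pi * real k / real r))\<^sup>2)
           = real m * (real r - real m)"
  using assms(2)
proof (induction m rule: less_induct)
  case (less m)
  let ?s = "\<lambda>k. sin (pi * real k / real r)"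
  let ?T = "\<lambda>m. \<Sum>k=1..<r. (sin (pi * real m * real k / real r))\<^sup>2 / (?s k)\<^sup>2"
  have pos: "?s k > 0" if "k \<in> {1..<r}" for k
    using that by (intro sin_gt_zero) (auto simp: field_simps)
  consider "m = 0" | "m = 1" | n where "m = Suc (Suc n)"
    by (metis One_nat_def old.nat.exhaust)
  then show ?case
  proof cases
    case 2
    have "?T 1 = (\<Sum>k=1..<r. 1)"
      using pos by (intro sum.cong) force+
    then show ?thesis using 2 assms by simp
  next
    case 3
    define x where "x k = pi * real k / real r" for k
    have dd: "(sin (real (n + 2) * t))\<^sup>2 = 2 * (sin (real (n + 1) * t))\<^sup>2 - (sin (real n * t))\<^sup>2
        + 2 * cos (2 * real (n + 1) * t) * (sin t)\<^sup>2" for t :: real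
    proof -
      have *: "(sin u)\<^sup>2 = (1 - cos (2 * u)) / 2" for u :: real
        using cos_double_sin[of u] by simp
      have "cos (2 * real (n + 1) * t + 2 * t) + cos (2 * real (n + 1) * t - 2 * t)
          = 2 * cos (2 * real (n + 1) * t) * cos (2 * t)"
        by (simp add: cos_add cos_diff)
      moreover have "2 * (real (n + 2) * t) = 2 * real (n + 1) * t + 2 * t"
          "2 * (real n * t) = 2 * real (n + 1) * t - 2 * t"
          "2 * (real (n + 1) * t) = 2 * real (n + 1) * t"
        by (simp_all add: algebra_simps)
      ultimately show ?thesis
        unfolding *[of "real (n + 2) * t"] *[of "real (n + 1) * t"] *[of "real n * t"] *[of t]
        by (simp add: field_simps)
    qed
    have "?T m = (\<Sum>k=1..<r. (sin (real (n + 2) * x k))\<^sup>2 / (sin (x k))\<^sup>2)"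
      by (simp add: x_def 3 mult_ac)
    also have "\<dots> = (\<Sum>k=1..<r. 2 * ((sin (real (n + 1) * x k))\<^sup>2 / (sin (x k))\<^sup>2)
        - (sin (real n * x k))\<^sup>2 / (sin (x k))\<^sup>2 + 2 * cos (2 * real (n + 1) * x k))"
    proof (intro sum.cong refl)
      fix k assume "k \<in> {1..<r}"
      then have "sin (x k) \<noteq> 0" using pos by (force simp: x_def)
      then show "(sin (real (n + 2) * x k))\<^sup>2 / (sin (x k))\<^sup>2 =
          2 * ((sin (real (n + 1) * x k))\<^sup>2 / (sin (x k))\<^sup>2)
          - (sin (real n * x k))\<^sup>2 / (sin (x k))\<^sup>2 + 2 * cos (2 * real (n + 1) * x k)"
        unfolding dd by (simp add: add_divide_distrib diff_divide_distrib)
    qed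
    also have "\<dots> = 2 * ?T (n + 1) - ?T n + 2 * (\<Sum>k=1..<r. cos (2 * real (n + 1) * x k))"
      by (simp add: sum.distrib sum_subtractf sum_distrib_left x_def mult_ac)
    also have "(\<Sum>k=1..<r. cos (2 * real (n + 1) * x k)) = -1"
    proof -
      have "\<not> int r dvd int (n + 1)"
        unfolding int_dvd_int_iff using less.prems 3 by (intro nat_dvd_not_less) auto
      then have "(\<Sum>k<r. cos (2 * pi * real_of_int (int (n + 1)) * real k / real r)) = 0"
        using assms by (intro sum_cos_roots_of_unity) auto
      also have "{..<r} = insert 0 {1..<r}" using assms by auto
      finally show ?thesis by (simp add: x_def mult_ac)
    qed
    also have "?T (n + 1) = real (n + 1) * (real r - real (n + 1))"
      using less.prems 3 by (intro less.IH) auto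
    also have "?T n = real n * (real r - real n)"
      using less.prems 3 by (intro less.IH) auto
    finally show ?thesis using 3 by (simp add: algebra_simps)
  qed simp
qed

text \<open>
  Average \<open>sum_sin_squares_ratio\<close> over \<open>m\<close>: each numerator \<open>(sin (pi * m * k / r))\<^sup>2\<close> has mean \<open>1 / 2\<close>, so the
  left-hand sides add up to \<open>r / 2\<close> times the wanted sum.
\<close>
lemma sum_inverse_sin_squares:
  assumes "r \<ge> 1"
  shows "(\<Sum>k=1..<r. 1 / (sin (pi * real k / real r))\<^sup>2) = (real r ^ 2 - 1) / 3"
proof -
  let ?s = "\<lambda>k. sin (pi * real k / real r)"
  have avg: "(\<Sum>m<r. (sin (pi * real m * real k / real r))\<^sup>2) = real r / 2" if "k \<in> {1..<r}" for k
  proof -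
    have *: "(sin u)\<^sup>2 = (1 - cos (2 * u)) / 2" for u :: real
      using cos_double_sin[of u] by simp
    have "\<not> int r dvd int k"
      unfolding int_dvd_int_iff using that by (intro nat_dvd_not_less) auto
    then have "(\<Sum>m<r. cos (2 * pi * real_of_int (int k) * real m / real r)) = 0"
      using assms by (intro sum_cos_roots_of_unity) auto
    then have "(\<Sum>m<r. cos (2 * (pi * real m * real k / real r))) = 0" by (simp add: mult_ac)
    then show ?thesis unfolding * by (simp add: sum_subtractf flip: sum_divide_distrib)
  qed
  have tri: "(\<Sum>m<n. real m * (c - real m)) = real n * (real n - 1) * (3 * c - 2 * real n + 1) / 6"
    for n :: nat and c :: real
    by (induction n) (simp_all add: field_simps)
  have "real r * (real r ^ 2 - 1) / 6 = (\<Sum>m<r. real m * (real r - real m))"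
    unfolding tri by (simp add: field_simps power2_eq_square)
  also have "\<dots> = (\<Sum>m<r. \<Sum>k=1..<r. (sin (pi * real m * real k / real r))\<^sup>2 / (?s k)\<^sup>2)"
    using assms by (intro sum.cong refl sum_sin_squares_ratio[symmetric]) auto
  also have "\<dots> = (\<Sum>k=1..<r. (\<Sum>m<r. (sin (pi * real m * real k / real r))\<^sup>2) / (?s k)\<^sup>2)"
    by (subst sum.swap) (simp add: sum_divide_distrib)
  also have "\<dots> = (\<Sum>k=1..<r. real r / 2 * (1 / (?s k)\<^sup>2))"
    by (intro sum.cong refl) (simp only: avg, simp)
  also have "\<dots> = real r / 2 * (\<Sum>k=1..<r. 1 / (?s k)\<^sup>2)"
    by (simp only: sum_distrib_left)
  finally have "real r * ((real r ^ 2 - 1) / 3) = real r * (\<Sum>k=1..<r. 1 / (?s k)\<^sup>2)"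
    by simp
  then show ?thesis using assms by (simp only: mult_cancel_left) auto
qed

text \<open>
  The summand depends only on \<open>l - l'\<close> modulo \<open>r\<close>, so every point of a regular \<open>r\<close>-gon sees the others in the
  same way. The term \<open>l' = l\<close> contributes \<open>1 / 0 = 0\<close>.
\<close>
lemma sum_inverse_sin_squares_differences:
  assumes l: "l \<in> {1..r}"
  shows "(\<Sum>l'=1..r. 1 / (sin (pi * (real l - real l') / real r))\<^sup>2) = (real r ^ 2 - 1) / 3"
proof -
  define g where "g k = 1 / (sin (pi * real k / real r))\<^sup>2" for k :: nat
  have r: "r \<ge> 1" using l by auto
  have "(\<Sum>l'=1..r. 1 / (sin (pi * (real l - real l') / real r))\<^sup>2)
      = (\<Sum>l'\<in>{1..r} - {l}. 1 / (sin (pi * (real l - real l') / real r))\<^sup>2)"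
    by (intro sum.mono_neutral_right) auto
  also have "\<dots> = (\<Sum>k=1..<r. g k)"
  proof -
    \<comment> \<open>Number the other points by their cyclic distance behind \<open>l\<close>; this numbering is its own inverse.\<close>
    define i where "i k = (if k < l then l - k else l + r - k)" for k
    have refl: "g (i l') = 1 / (sin (pi * (real l - real l') / real r))\<^sup>2" if "l' \<in> {1..r} - {l}" for l'
    proof (cases "l' < l")
      case True
      then show ?thesis by (simp add: g_def i_def of_nat_diff)
    next
      case False
      have "pi * real (l + r - l') / real r = pi * (real l - real l') / real r + pi"
        using that l r by (simp add: of_nat_diff field_simps)
      then show ?thesis using False by (simp add: g_def i_def)
    qed
    show ?thesis
      by (rule sum.reindex_bij_witness[of _ i i]) (use l refl in \<open>auto simp: i_def split: if_splits\<close>)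
  qed
  finally show ?thesis using sum_inverse_sin_squares[OF r] by (simp add: g_def)
qed

section \<open>Parallels and poles of the sphere\<close>

definition sphere_point :: "real \<Rightarrow> real \<Rightarrow> real ^ 3" where
  "sphere_point h \<alpha> = vector [sqrt (1 - h\<^sup>2) * cos \<alpha>, sqrt (1 - h\<^sup>2) * sin \<alpha>, h]"

text \<open>
  The poles are treated as degenerate parallels with the indices \<open>0\<close> and \<open>2 * m\<close>, each carrying one
  point. This makes the whole ensemble one family of rings, and the reflection \<open>j \<mapsto> 2 * m - j\<close> in the
  equatorial plane acts on all of them.
\<close>
definition ring_size :: "nat \<Rightarrow> nat \<Rightarrow> nat" where
  "ring_size m j = (if j = 0 \<or> j = 2 * m then 1 else diamond_r m j)"

definition ring_height :: "nat \<Rightarrow> nat \<Rightarrow> real" where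
  "ring_height m j = (if j = 0 then 1 else if j = 2 * m then - 1 else diamond_z m j)"

definition ring_point :: "nat \<Rightarrow> (nat \<Rightarrow> real) \<Rightarrow> nat \<Rightarrow> nat \<Rightarrow> real ^ 3" where
  "ring_point m \<theta> j l = sphere_point (ring_height m j) (2 * pi * real l / real (ring_size m j) + \<theta> j)"

text \<open>
  The form \<open>a - b * cos (\<alpha> - \<beta>)\<close> of the squared distance is the one required for averaging over the phases.
\<close>
lemma norm_sphere_point_diff:
  assumes "\<bar>h\<bar> \<le> 1" "\<bar>k\<bar> \<le> 1"
  shows "(norm (sphere_point h \<alpha> - sphere_point k \<beta>))\<^sup>2
           = (2 - 2 * h * k) - 2 * (sqrt (1 - h\<^sup>2) * sqrt (1 - k\<^sup>2)) * cos (\<alpha> - \<beta>)"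
proof -
  have *: "(sqrt (1 - h\<^sup>2))\<^sup>2 = 1 - h\<^sup>2" "(sqrt (1 - k\<^sup>2))\<^sup>2 = 1 - k\<^sup>2"
    using assms by (auto simp: abs_square_le_1)
  have alg: "(s * c - t * d)\<^sup>2 + (s * c' - t * d')\<^sup>2 = s\<^sup>2 * (c\<^sup>2 + c'\<^sup>2) + t\<^sup>2 * (d\<^sup>2 + d'\<^sup>2) - 2 * (s * t) * (c * d + c' * d')"
    for s t c d c' d' :: real by algebra
  have "(norm (sphere_point h \<alpha> - sphere_point k \<beta>))\<^sup>2
      = (sqrt (1 - h\<^sup>2) * cos \<alpha> - sqrt (1 - k\<^sup>2) * cos \<beta>)\<^sup>2
        + (sqrt (1 - h\<^sup>2) * sin \<alpha> - sqrt (1 - k\<^sup>2) * sin \<beta>)\<^sup>2 + (h - k)\<^sup>2"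
    unfolding power2_norm_eq_inner inner_vec_def sum_3 by (simp add: sphere_point_def power2_eq_square)
  also have "\<dots> = (1 - h\<^sup>2) + (1 - k\<^sup>2) - 2 * (sqrt (1 - h\<^sup>2) * sqrt (1 - k\<^sup>2)) * cos (\<alpha> - \<beta>) + (h - k)\<^sup>2"
    unfolding alg * by (simp add: cos_diff)
  finally show ?thesis by (simp add: power2_eq_square algebra_simps)
qed

lemma norm_sphere_point_diff_same_height:
  assumes "\<bar>h\<bar> \<le> 1"
  shows "(norm (sphere_point h \<alpha> - sphere_point h \<beta>))\<^sup>2 = 4 * (1 - h\<^sup>2) * (sin ((\<alpha> - \<beta>) / 2))\<^sup>2"
proof -
  have *: "sqrt (1 - h\<^sup>2) * sqrt (1 - h\<^sup>2) = 1 - h\<^sup>2" using assms by (simp add: abs_square_le_1)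
  have "(norm (sphere_point h \<alpha> - sphere_point h \<beta>))\<^sup>2 = 2 * (1 - h\<^sup>2) * (1 - cos (\<alpha> - \<beta>))"
    unfolding norm_sphere_point_diff[OF assms assms] * by (simp add: power2_eq_square algebra_simps)
  also have "\<alpha> - \<beta> = 2 * ((\<alpha> - \<beta>) / 2)" by simp
  also have "2 * (1 - h\<^sup>2) * (1 - cos (2 * ((\<alpha> - \<beta>) / 2))) = 4 * (1 - h\<^sup>2) * (sin ((\<alpha> - \<beta>) / 2))\<^sup>2"
    unfolding cos_double_sin by (simp add: algebra_simps)
  finally show ?thesis by simp
qed

lemma norm_sphere_point:
  assumes "\<bar>h\<bar> \<le> 1"
  shows "norm (sphere_point h \<alpha>) = 1"
proof -
  have *: "(sqrt (1 - h\<^sup>2))\<^sup>2 = 1 - h\<^sup>2" using assms by (auto simp: abs_square_le_1)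
  have "(norm (sphere_point h \<alpha>))\<^sup>2 = (sqrt (1 - h\<^sup>2))\<^sup>2 * ((cos \<alpha>)\<^sup>2 + (sin \<alpha>)\<^sup>2) + h\<^sup>2"
    unfolding power2_norm_eq_inner inner_vec_def sum_3
    by (simp only: sphere_point_def vector_3 inner_real_def) algebra
  also have "\<dots> = 1" unfolding * by simp
  finally show ?thesis by (simp add: power2_eq_1_iff)
      (metis norm_ge_zero one_neq_neg_one not_one_le_zero neg_0_le_iff_le)
qed

lemma diamond_r_reflect: "j \<le> 2 * m \<Longrightarrow> diamond_r m (2 * m - j) = diamond_r m j"
  by (auto simp: diamond_r_def)

lemma ring_height_north:
  assumes "1 \<le> j" "j \<le> m"
  shows "ring_height m j = 4 * (real m ^ 2 - real j ^ 2) / (1 + 4 * real m ^ 2)"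
  using assms by (simp add: ring_height_def diamond_z_def)

lemma ring_height_reflect:
  assumes "m \<ge> 1" "j \<le> 2 * m"
  shows "ring_height m (2 * m - j) = - ring_height m j"
  using assms by (cases "j = m") (auto simp: ring_height_def diamond_z_def)

lemma ring_height_pos: "j < m \<Longrightarrow> ring_height m j > 0"
  by (cases "j = 0")
     (auto simp: ring_height_north ring_height_def[of _ 0] power_strict_mono intro!: divide_pos_pos add_pos_nonneg)

lemma ring_height_strict_decreasing:
  assumes m: "m \<ge> 1" and "i < j" "j \<le> 2 * m"
  shows "ring_height m j < ring_height m i"
proof -
  have north: "ring_height m j < ring_height m i" if ij: "i < j" "j \<le> m" for i j
  proof (cases "i = 0")
    case True
    have "1 + 4 * real m ^ 2 > 0" by (simp add: add_pos_nonneg)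
    moreover have "-1 < 4 * real j ^ 2" by (rule less_le_trans[of _ 0]) auto
    ultimately have "ring_height m j < 1"
      using ij by (simp add: ring_height_north pos_divide_less_eq)
    then show ?thesis using True by (simp add: ring_height_def[of _ 0])
  next
    case False
    have "real i ^ 2 < real j ^ 2" using ij by (intro power_strict_mono) auto
    then show ?thesis using ij False
      by (auto simp: ring_height_north intro!: divide_strict_right_mono add_pos_nonneg)
  qed
  consider "j \<le> m" | "i < m" "j > m" | "i \<ge> m" by linarith
  then show ?thesis
  proof cases
    case 1
    then show ?thesis using north assms by auto
  next
    case 2
    have "ring_height m i > 0" using 2 ring_height_pos by auto
    moreover have "ring_height m (2 * m - j) > 0" using 2 m by (intro ring_height_pos) auto
    ultimately show ?thesis using ring_height_reflect[OF m assms(3)] by linarith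
  next
    case 3
    have "ring_height m (2 * m - i) < ring_height m (2 * m - j)"
      using 3 assms by (intro north) auto
    then show ?thesis using ring_height_reflect[OF m, of i] ring_height_reflect[OF m, of j] assms by auto
  qed
qed

lemma ring_height_inj:
  assumes "m \<ge> 1" "i \<le> 2 * m" "j \<le> 2 * m" "i \<noteq> j"
  shows "ring_height m i \<noteq> ring_height m j"
  using ring_height_strict_decreasing[of m i j] ring_height_strict_decreasing[of m j i] assms
  by (cases "i < j") auto

lemma abs_ring_height_less:
  assumes "m \<ge> 1" "1 \<le> j" "j < 2 * m"
  shows "\<bar>ring_height m j\<bar> < 1"
  using ring_height_strict_decreasing[of m 0 j] ring_height_strict_decreasing[of m j "2 * m"] assms
  by (auto simp: ring_height_def[of _ 0] ring_height_def[of _ "2 * m"])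

lemma abs_ring_height_le:
  assumes "m \<ge> 1" "j \<le> 2 * m"
  shows "\<bar>ring_height m j\<bar> \<le> 1"
  using abs_ring_height_less[of m j] assms
  by (cases "j = 0 \<or> j = 2 * m") (auto simp: ring_height_def[of _ 0] ring_height_def[of _ "2 * m"])

lemma ring_size_pos: "j \<le> 2 * m \<Longrightarrow> ring_size m j \<ge> 1"
  by (auto simp: ring_size_def diamond_r_def)

lemma ring_split: "(m :: nat) \<ge> 1 \<Longrightarrow> {0..2 * m} = {0, 2 * m} \<union> {1..2 * m - 1}"
  by auto

lemma diamond_ensemble_eq_rings:
  assumes m: "m \<ge> 1"
  shows "diamond_ensemble m \<theta> =
           (\<lambda>(j, l). ring_point m \<theta> j l) ` (SIGMA j:{0..2 * m}. {1..ring_size m j})"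
proof -
  have 1: "ring_point m \<theta> 0 l = vector [0, 0, 1]" "ring_point m \<theta> (2 * m) l = vector [0, 0, - 1]" for l
    using m by (simp_all add: ring_point_def sphere_point_def ring_height_def)
  have 2: "ring_point m \<theta> j l = diamond_point m \<theta> j l" "ring_size m j = diamond_r m j"
    if "j \<in> {1..2 * m - 1}" for j l
    using that m by (auto simp: ring_point_def sphere_point_def ring_height_def ring_size_def diamond_point_def)
  have 3: "ring_size m 0 = 1" "ring_size m (2 * m) = 1" by (auto simp: ring_size_def)
  have "(\<lambda>(j, l). ring_point m \<theta> j l) ` (SIGMA j:{0..2 * m}. {1..ring_size m j})
      = (\<Union>j\<in>{0..2 * m}. ring_point m \<theta> j ` {1..ring_size m j})" by auto
  also have "\<dots> = {vector [0, 0, 1], vector [0, 0, - 1]} \<union>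
      (\<Union>j\<in>{1..2 * m - 1}. ring_point m \<theta> j ` {1..ring_size m j})"
    unfolding ring_split[OF m] by (auto simp: 1 3)
  also have "\<dots> = diamond_ensemble m \<theta>"
    unfolding diamond_ensemble_def using 2 by (fastforce simp: image_iff)
  finally show ?thesis ..
qed

text \<open>
  Points on different rings differ in their heights, points on the same ring by an angle that is
  not a multiple of a full turn.
\<close>
lemma inj_on_ring_point:
  assumes m: "m \<ge> 1"
  shows "inj_on (\<lambda>(j, l). ring_point m \<theta> j l) (SIGMA j:{0..2 * m}. {1..ring_size m j})"
proof -
  have "j = j' \<and> l = l'"
    if j: "j \<le> 2 * m" "j' \<le> 2 * m" and l: "l \<in> {1..ring_size m j}" "l' \<in> {1..ring_size m j'}"
      and eq: "ring_point m \<theta> j l = ring_point m \<theta> j' l'" for j j' l l'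
  proof -
    have "ring_point m \<theta> j l $ 3 = ring_point m \<theta> j' l' $ 3" using eq by simp
    then have jj: "j = j'"
      using ring_height_inj[OF m j] by (auto simp: ring_point_def sphere_point_def)
    have "l = l'"
    proof (cases "j = 0 \<or> j = 2 * m")
      case True
      then show ?thesis using l jj by (auto simp: ring_size_def)
    next
      case False
      define r where "r = ring_size m j"
      have r: "r > 0" using ring_size_pos[OF j(1)] by (simp add: r_def)
      have h: "\<bar>ring_height m j\<bar> < 1" using False j m by (intro abs_ring_height_less) auto
      then have "1 - (ring_height m j)\<^sup>2 > 0" by (simp add: abs_square_less_1)
      moreover have "4 * (1 - (ring_height m j)\<^sup>2) *
          (sin ((2 * pi * real l / real r - 2 * pi * real l' / real r) / 2))\<^sup>2 = 0"
        using norm_sphere_point_diff_same_height[of "ring_height m j"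
            "2 * pi * real l / real r + \<theta> j" "2 * pi * real l' / real r + \<theta> j"] h eq jj
        by (simp add: ring_point_def r_def)
      ultimately have "sin ((2 * pi * real l / real r - 2 * pi * real l' / real r) / 2) = 0" by simp
      moreover have "(2 * pi * real l / real r - 2 * pi * real l' / real r) / 2 = (real l - real l') / real r * pi"
        by (simp add: diff_divide_distrib algebra_simps)
      ultimately obtain i :: int where "(real l - real l') / real r * pi = of_int i * pi"
        by (auto simp only: sin_zero_iff_int2)
      then have "(real l - real l') / real r = of_int i"
        using pi_neq_zero by (simp only: mult_cancel_right) simp
      then have "real l - real l' = of_int i * real r" using r by (simp add: field_simps)
      then have "real_of_int (int l - int l') = real_of_int (i * int r)" by simp
      then have il: "int l - int l' = i * int r" by linarith
      have "\<bar>int l - int l'\<bar> < int r" using l jj by (auto simp: r_def)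
      then have "\<bar>i\<bar> * int r < 1 * int r" unfolding il by (simp add: abs_mult)
      then have "i = 0" using r by (simp only: mult_less_cancel_right) auto
      then show ?thesis using il by simp
    qed
    with jj show ?thesis by simp
  qed
  then show ?thesis by (auto simp: inj_on_def)
qed

text \<open>
  Pairs each northern parallel with its mirror image; the equator \<open>j = m\<close> is its own image.
\<close>
lemma sum_over_parallels_fold:
  fixes f :: "nat \<Rightarrow> 'b :: comm_monoid_add"
  assumes m: "m \<ge> 1"
  shows "(\<Sum>j=1..2 * m - 1. f j) = (\<Sum>j=1..<m. f j + f (2 * m - j)) + f m"
proof -
  have "{1..2 * m - 1} = ({1..<m} \<union> {m + 1..2 * m - 1}) \<union> {m}" using m by auto
  then have "(\<Sum>j=1..2 * m - 1. f j) = (\<Sum>j=1..<m. f j) + (\<Sum>j=m + 1..2 * m - 1. f j) + f m"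
    by (simp only:) (subst sum.union_disjoint; (subst sum.union_disjoint)?; auto simp: add_ac)
  also have "(\<Sum>j=m + 1..2 * m - 1. f j) = (\<Sum>j=1..<m. f (2 * m - j))"
    by (rule sum.reindex_bij_witness[of _ "\<lambda>j. 2 * m - j" "\<lambda>j. 2 * m - j"]) auto
  finally show ?thesis by (simp add: sum.distrib)
qed

lemma diamond_ensemble_card:
  assumes m: "m \<ge> 1"
  shows "finite (diamond_ensemble m \<theta>)" "card (diamond_ensemble m \<theta>) = diamond_N m"
proof -
  show "finite (diamond_ensemble m \<theta>)"
    unfolding diamond_ensemble_eq_rings[OF m] by auto
  \<comment> \<open>Each northern parallel and its mirror image carry \<open>8 * j\<close> points together, the equator \<open>4 * m\<close>.\<close>
  have gauss: "(\<Sum>j=1..<n. 8 * j) + 4 * n = 4 * n ^ 2" for n :: nat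
    by (induction n) (auto simp: power2_eq_square sum.atLeastLessThan_Suc not_le)
  have "card (diamond_ensemble m \<theta>) = (\<Sum>j\<in>{0..2 * m}. ring_size m j)"
    unfolding diamond_ensemble_eq_rings[OF m] card_image[OF inj_on_ring_point[OF m]] by simp
  also have "\<dots> = (\<Sum>j\<in>{0, 2 * m}. ring_size m j) + (\<Sum>j=1..2 * m - 1. ring_size m j)"
    unfolding ring_split[OF m] by (rule sum.union_disjoint) auto
  also have "(\<Sum>j\<in>{0, 2 * m}. ring_size m j) = 2" using m by (simp add: ring_size_def)
  also have "(\<Sum>j=1..2 * m - 1. ring_size m j) = (\<Sum>j=1..<m. 8 * j) + 4 * m"
    unfolding sum_over_parallels_fold[OF m]
    by (intro arg_cong2[where f = plus] sum.cong) (use m in \<open>auto simp: ring_size_def diamond_r_def\<close>)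
  finally show "card (diamond_ensemble m \<theta>) = diamond_N m"
    unfolding gauss by (simp add: diamond_N_def)
qed

lemma diamond_ensemble_subset_sphere:
  assumes m: "m \<ge> 1"
  shows "diamond_ensemble m \<theta> \<subseteq> sphere 0 1"
  unfolding diamond_ensemble_eq_rings[OF m]
  by (auto simp: ring_point_def norm_sphere_point abs_ring_height_le[OF m])

section \<open>The expected energy as a sum over pairs of rings\<close>

text \<open>
  The diagonal can be included because its terms are \<open>1 / 0 = 0\<close>.
\<close>
lemma riesz_2_energy_eq_double_sum:
  assumes "finite A"
  shows "riesz_2_energy A = (\<Sum>x\<in>A. \<Sum>y\<in>A. 1 / (norm (x - y))\<^sup>2)"
proof -
  have "(\<Sum>x\<in>A. \<Sum>y\<in>A. 1 / (norm (x - y))\<^sup>2) = (\<Sum>(x, y)\<in>A \<times> A. 1 / (norm (x - y))\<^sup>2)"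
    by (rule sum.cartesian_product)
  also have "\<dots> = riesz_2_energy A"
    unfolding riesz_2_energy_def using assms by (intro sum.mono_neutral_right) auto
  finally show ?thesis ..
qed

lemma riesz_2_energy_diamond:
  assumes m: "m \<ge> 1"
  shows "riesz_2_energy (diamond_ensemble m \<theta>) =
    (\<Sum>i=0..2*m. \<Sum>j=0..2*m. \<Sum>k=1..ring_size m i. \<Sum>l=1..ring_size m j.
       1 / (norm (ring_point m \<theta> i k - ring_point m \<theta> j l))\<^sup>2)"
proof -
  let ?I = "SIGMA j:{0..2 * m}. {1..ring_size m j}"
  have reindex: "(\<Sum>x\<in>diamond_ensemble m \<theta>. f x) = (\<Sum>i=0..2*m. \<Sum>k=1..ring_size m i. f (ring_point m \<theta> i k))"
    for f :: "real ^ 3 \<Rightarrow> real"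
    unfolding diamond_ensemble_eq_rings[OF m] sum.reindex[OF inj_on_ring_point[OF m]]
    by (subst sum.Sigma) (auto simp: case_prod_unfold)
  show ?thesis
    unfolding riesz_2_energy_eq_double_sum[OF diamond_ensemble_card(1)[OF m]] reindex
    by (intro sum.cong refl sum.swap)
qed

text \<open>
  Within one ring the phases cancel, so this part of the energy is deterministic. For the two
  poles both sides vanish: \<open>ring_size\<close> is \<open>1\<close>.
\<close>
lemma same_ring_energy:
  assumes m: "m \<ge> 1" and j: "j \<le> 2 * m"
  shows "(\<Sum>k=1..ring_size m j. \<Sum>l=1..ring_size m j.
            1 / (norm (ring_point m \<theta> j k - ring_point m \<theta> j l))\<^sup>2)
         = real (ring_size m j) * (real (ring_size m j) ^ 2 - 1) / (12 * (1 - (ring_height m j)\<^sup>2))"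
proof -
  define r where "r = ring_size m j"
  define h where "h = ring_height m j"
  have h: "\<bar>h\<bar> \<le> 1" using abs_ring_height_le[OF m j] by (simp add: h_def)
  have "1 / (norm (ring_point m \<theta> j k - ring_point m \<theta> j l))\<^sup>2
      = 1 / (4 * (1 - h\<^sup>2)) * (1 / (sin (pi * (real k - real l) / real r))\<^sup>2)" for k l
  proof -
    have "(2 * pi * real k / real r + \<theta> j - (2 * pi * real l / real r + \<theta> j)) / 2 = pi * (real k - real l) / real r"
      by (simp add: diff_divide_distrib right_diff_distrib)
    then show ?thesis
      unfolding ring_point_def norm_sphere_point_diff_same_height[OF h[unfolded h_def]]
      by (simp add: h_def r_def)
  qed
  then have "(\<Sum>k=1..r. \<Sum>l=1..r. 1 / (norm (ring_point m \<theta> j k - ring_point m \<theta> j l))\<^sup>2)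
      = (\<Sum>k=1..r. 1 / (4 * (1 - h\<^sup>2)) * (\<Sum>l=1..r. 1 / (sin (pi * (real k - real l) / real r))\<^sup>2))"
    by (simp only: sum_distrib_left)
  also have "\<dots> = (\<Sum>k=1..r. 1 / (4 * (1 - h\<^sup>2)) * ((real r ^ 2 - 1) / 3))"
    by (intro sum.cong refl arg_cong2[where f = times] sum_inverse_sin_squares_differences)
  finally show ?thesis by (simp add: r_def h_def)
qed

text \<open>
  Write the squared distance as \<open>a - b * cos (c + \<theta> i - \<theta> j)\<close>. For points on the unit sphere the discriminant
  \<open>a\<^sup>2 - b\<^sup>2\<close> collapses to \<open>(2 * (h i - h j))\<^sup>2\<close>, so the mean interaction depends on the heights only through
  their difference. If one of the points is a pole, then \<open>b = 0\<close> and the same formula holds without any averaging.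
\<close>
lemma (in prob_space) expected_ring_pair_interaction:
  assumes m: "m \<ge> 1"
    and ind: "indep_vars (\<lambda>_. borel) \<theta> {1..2 * m - 1}"
    and unif: "\<And>j. j \<in> {1..2 * m - 1} \<Longrightarrow> distr M borel (\<theta> j) = uniform_measure lborel {0..2 * pi}"
    and ij: "i \<le> 2 * m" "j \<le> 2 * m" "i \<noteq> j"
  shows "integrable M (\<lambda>\<omega>. 1 / (norm (ring_point m (\<lambda>j. \<theta> j \<omega>) i k - ring_point m (\<lambda>j. \<theta> j \<omega>) j l))\<^sup>2)"
      (is "integrable M ?f")
    and "expectation (\<lambda>\<omega>. 1 / (norm (ring_point m (\<lambda>j. \<theta> j \<omega>) i k - ring_point m (\<lambda>j. \<theta> j \<omega>) j l))\<^sup>2)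
           = 1 / (2 * \<bar>ring_height m i - ring_height m j\<bar>)"
proof -
  define h where "h = ring_height m"
  have h: "\<bar>h i\<bar> \<le> 1" "\<bar>h j\<bar> \<le> 1" "h i \<noteq> h j"
    using abs_ring_height_le[OF m] ring_height_inj[OF m] ij by (auto simp: h_def)
  define a where "a = 2 - 2 * h i * h j"
  define b where "b = 2 * (sqrt (1 - (h i)\<^sup>2) * sqrt (1 - (h j)\<^sup>2))"
  define c where "c = 2 * pi * real k / real (ring_size m i) - 2 * pi * real l / real (ring_size m j)"
  have f: "?f = (\<lambda>\<omega>. 1 / (a - b * cos (c + \<theta> i \<omega> - \<theta> j \<omega>)))"
    unfolding ring_point_def norm_sphere_point_diff[OF h(1,2)[unfolded h_def]] a_def b_def c_def h_def
    by (simp add: algebra_simps)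
  have "b\<^sup>2 = 4 * ((1 - (h i)\<^sup>2) * (1 - (h j)\<^sup>2))"
    using h by (simp add: b_def power_mult_distrib abs_square_le_1)
  then have ab2: "a\<^sup>2 - b\<^sup>2 = (2 * (h i - h j))\<^sup>2"
    by (simp add: a_def power2_eq_square algebra_simps)
  have sq: "sqrt (a\<^sup>2 - b\<^sup>2) = 2 * \<bar>h i - h j\<bar>"
    unfolding ab2 real_sqrt_abs abs_mult by simp
  have "\<bar>h i * h j\<bar> \<le> 1 * 1" unfolding abs_mult using h by (intro mult_mono) auto
  then have a0: "a \<ge> 0" by (simp add: a_def)
  have "(2 * (h i - h j))\<^sup>2 > 0" using h(3) by simp
  then have "\<bar>b\<bar>\<^sup>2 < a\<^sup>2" unfolding power2_abs using ab2 by linarith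
  then have ab: "\<bar>b\<bar> < a" using a0 by (rule power2_less_imp_less)
  have "integrable M ?f \<and> expectation ?f = 1 / sqrt (a\<^sup>2 - b\<^sup>2)"
  proof (cases "i \<in> {1..2 * m - 1} \<and> j \<in> {1..2 * m - 1}")
    case True
    then have "indep_var borel (\<theta> i) borel (\<theta> j)"
      using indep_vars_imp_indep_var[OF ind] ij by simp
    from expectation_inverse_cos_uniform_phases[OF this unif unif ab] True
    show ?thesis unfolding f by simp
  next
    case False
    then have "(i = 0 \<or> i = 2 * m) \<or> (j = 0 \<or> j = 2 * m)" using ij by auto
    then have "b = 0" using m by (auto simp: b_def h_def ring_height_def)
    then show ?thesis unfolding f using a0 by (simp add: prob_space)
  qed
  then show "integrable M ?f" "expectation ?f = 1 / (2 * \<bar>ring_height m i - ring_height m j\<bar>)"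
    by (simp_all add: sq h_def)
qed

text \<open>
  The mean over the phases. On the diagonal the energy does not depend on them.
\<close>
definition ring_pair_energy :: "nat \<Rightarrow> nat \<Rightarrow> nat \<Rightarrow> real" where
  "ring_pair_energy m i j = (if i = j
     then real (ring_size m j) * (real (ring_size m j) ^ 2 - 1) / (12 * (1 - (ring_height m j)\<^sup>2))
     else real (ring_size m i) * real (ring_size m j) / (2 * \<bar>ring_height m i - ring_height m j\<bar>))"

lemma (in prob_space) expected_riesz_2_energy:
  assumes m: "m \<ge> 1"
    and ind: "indep_vars (\<lambda>_. borel) \<theta> {1..2 * m - 1}"
    and unif: "\<And>j. j \<in> {1..2 * m - 1} \<Longrightarrow> distr M borel (\<theta> j) = uniform_measure lborel {0..2 * pi}"
  shows "integrable M (\<lambda>\<omega>. riesz_2_energy (diamond_ensemble m (\<lambda>j. \<theta> j \<omega>)))"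
    and "expectation (\<lambda>\<omega>. riesz_2_energy (diamond_ensemble m (\<lambda>j. \<theta> j \<omega>)))
           = (\<Sum>i=0..2*m. \<Sum>j=0..2*m. ring_pair_energy m i j)"
proof -
  define F where "F i j \<omega> = (\<Sum>k=1..ring_size m i. \<Sum>l=1..ring_size m j.
       1 / (norm (ring_point m (\<lambda>j. \<theta> j \<omega>) i k - ring_point m (\<lambda>j. \<theta> j \<omega>) j l))\<^sup>2)" for i j \<omega>
  have F: "integrable M (F i j) \<and> expectation (F i j) = ring_pair_energy m i j"
    if ij: "i \<le> 2 * m" "j \<le> 2 * m" for i j
  proof (cases "i = j")
    case True
    then have "F i j = (\<lambda>\<omega>. ring_pair_energy m i j)"
      using same_ring_energy[OF m ij(1)] by (intro ext) (simp add: F_def ring_pair_energy_def)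
    then show ?thesis by (simp add: prob_space)
  next
    case False
    have 1: "integrable M (\<lambda>\<omega>. 1 / (norm (ring_point m (\<lambda>j. \<theta> j \<omega>) i k - ring_point m (\<lambda>j. \<theta> j \<omega>) j l))\<^sup>2)"
      "expectation (\<lambda>\<omega>. 1 / (norm (ring_point m (\<lambda>j. \<theta> j \<omega>) i k - ring_point m (\<lambda>j. \<theta> j \<omega>) j l))\<^sup>2)
           = 1 / (2 * \<bar>ring_height m i - ring_height m j\<bar>)" for k l
      using expected_ring_pair_interaction[OF m ind _ ij False] unif by blast+
    have int: "integrable M (\<lambda>\<omega>. \<Sum>l=1..ring_size m j.
       1 / (norm (ring_point m (\<lambda>j. \<theta> j \<omega>) i k - ring_point m (\<lambda>j. \<theta> j \<omega>) j l))\<^sup>2)" for k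
      by (intro Bochner_Integration.integrable_sum 1)
    have "integrable M (F i j)"
      unfolding F_def by (intro Bochner_Integration.integrable_sum 1)
    moreover have "expectation (F i j) = (\<Sum>k=1..ring_size m i. \<Sum>l=1..ring_size m j.
        1 / (2 * \<bar>ring_height m i - ring_height m j\<bar>))"
      unfolding F_def
      by (subst Bochner_Integration.integral_sum, rule int, subst Bochner_Integration.integral_sum, rule 1)
         (simp only: 1)
    then have "expectation (F i j) = ring_pair_energy m i j"
      using False by (simp add: ring_pair_energy_def)
    ultimately show ?thesis by blast
  qed
  have E: "(\<lambda>\<omega>. riesz_2_energy (diamond_ensemble m (\<lambda>j. \<theta> j \<omega>)))
      = (\<lambda>\<omega>. \<Sum>i=0..2*m. \<Sum>j=0..2*m. F i j \<omega>)"
    by (simp add: F_def riesz_2_energy_diamond[OF m])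
  show "integrable M (\<lambda>\<omega>. riesz_2_energy (diamond_ensemble m (\<lambda>j. \<theta> j \<omega>)))"
    unfolding E using F by (intro Bochner_Integration.integrable_sum) auto
  show "expectation (\<lambda>\<omega>. riesz_2_energy (diamond_ensemble m (\<lambda>j. \<theta> j \<omega>)))
           = (\<Sum>i=0..2*m. \<Sum>j=0..2*m. ring_pair_energy m i j)"
  proof -
    have int: "integrable M (\<lambda>\<omega>. F i j \<omega>)" if "i \<in> {0..2*m}" "j \<in> {0..2*m}" for i j
      using F[of i j] that by simp
    have "expectation (\<lambda>\<omega>. \<Sum>i=0..2*m. \<Sum>j=0..2*m. F i j \<omega>)
        = (\<Sum>i=0..2*m. expectation (\<lambda>\<omega>. \<Sum>j=0..2*m. F i j \<omega>))"
      by (rule Bochner_Integration.integral_sum) (rule Bochner_Integration.integrable_sum, rule int)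
    also have "\<dots> = (\<Sum>i=0..2*m. \<Sum>j=0..2*m. expectation (\<lambda>\<omega>. F i j \<omega>))"
      by (intro sum.cong refl Bochner_Integration.integral_sum int)
    also have "\<dots> = (\<Sum>i=0..2*m. \<Sum>j=0..2*m. ring_pair_energy m i j)"
      using F by (intro sum.cong refl) simp
    finally show ?thesis unfolding E .
  qed
qed

section \<open>Cesaro means and comparison of sums with integrals\<close>

text \<open>
  The Stolz-Cesaro principle: increments of size \<open>o(k)\<close> add up to \<open>o(n\<^sup>2)\<close>.
\<close>
lemma cesaro_linear_null:
  fixes d :: "nat \<Rightarrow> real"
  assumes d: "(\<lambda>k. d k / real (Suc k)) \<longlonglongrightarrow> 0"
  shows "(\<lambda>n. (\<Sum>k<n. d k) / real n ^ 2) \<longlonglongrightarrow> 0"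
proof (rule tendstoI)
  fix e :: real assume e: "e > 0"
  then obtain K where K: "\<And>k. k \<ge> K \<Longrightarrow> \<bar>d k / real (Suc k)\<bar> < e / 2"
    using LIMSEQ_D[OF d, of "e / 2"] by auto
  define C where "C = (\<Sum>k<K. \<bar>d k\<bar>)"
  have bound: "\<bar>\<Sum>k<n. d k\<bar> \<le> C + e / 2 * real n ^ 2" for n
  proof -
    have "\<bar>d k\<bar> \<le> (if k < K then \<bar>d k\<bar> else 0) + e / 2 * real (Suc k)" for k
      using K[of k] e by (cases "k < K") (auto simp: abs_divide pos_divide_less_eq)
    then have "(\<Sum>k<n. \<bar>d k\<bar>) \<le> (\<Sum>k<n. (if k < K then \<bar>d k\<bar> else 0) + e / 2 * real (Suc k))"
      by (intro sum_mono)
    also have "\<dots> = (\<Sum>k<n. if k < K then \<bar>d k\<bar> else 0) + e / 2 * (\<Sum>k<n. real (Suc k))"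
      by (simp only: sum.distrib sum_distrib_left)
    also have "(\<Sum>k<n. if k < K then \<bar>d k\<bar> else 0) = (\<Sum>k\<in>{..<n} \<inter> {..<K}. \<bar>d k\<bar>)"
      by (subst sum.inter_restrict) auto
    also have "\<dots> \<le> C" unfolding C_def by (intro sum_mono2) auto
    also have "(\<Sum>k<n. real (Suc k)) \<le> real n ^ 2"
      by (induction n) (auto simp: power2_eq_square algebra_simps)
    finally have "(\<Sum>k<n. \<bar>d k\<bar>) \<le> C + e / 2 * real n ^ 2"
      using e by (simp add: mult_left_mono)
    with sum_abs[of d "{..<n}"] show ?thesis by linarith
  qed
  have "(\<lambda>n. C / real n ^ 2) \<longlonglongrightarrow> 0" by real_asymp
  then have "eventually (\<lambda>n. C / real n ^ 2 < e / 2) sequentially"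
    using e by (intro order_tendstoD) auto
  then show "eventually (\<lambda>n. dist ((\<Sum>k<n. d k) / real n ^ 2) 0 < e) sequentially"
    using eventually_gt_at_top[of 0]
  proof eventually_elim
    case (elim n)
    have "\<bar>\<Sum>k<n. d k\<bar> / real n ^ 2 \<le> (C + e / 2 * real n ^ 2) / real n ^ 2"
      by (intro divide_right_mono bound) auto
    also have "\<dots> = C / real n ^ 2 + e / 2" using elim by (simp add: field_simps)
    also have "\<dots> < e" using elim by linarith
    finally show ?case by (simp add: abs_divide)
  qed
qed

text \<open>
  On each unit interval the mean value theorem places the increment of the primitive \<open>F\<close> between the
  values of \<open>f\<close> at the two ends.
\<close>
lemma monotone_sum_integral_bounds:
  fixes f F :: "real \<Rightarrow> real"
  assumes F: "\<And>x. 0 \<le> x \<Longrightarrow> x \<le> real n \<Longrightarrow> (F has_real_derivative f x) (at x)"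
    and f: "\<And>x y. 0 \<le> x \<Longrightarrow> x \<le> y \<Longrightarrow> y \<le> real n \<Longrightarrow> f x \<le> f y"
    and f0: "f 0 = 0"
  shows "F (real n) - F 0 \<le> (\<Sum>j=1..n. f (real j))"
    and "(\<Sum>j=1..n. f (real j)) \<le> F (real n) - F 0 + f (real n)"
proof -
  have step: "f (real k) \<le> F (real (Suc k)) - F (real k) \<and> F (real (Suc k)) - F (real k) \<le> f (real (Suc k))"
    if "k < n" for k
  proof -
    have "(F has_real_derivative f x) (at x)" if "real k \<le> x" "x \<le> real (Suc k)" for x
      using that \<open>k < n\<close> by (intro F) auto
    then obtain z where "real k < z" "z < real (Suc k)"
      "F (real (Suc k)) - F (real k) = (real (Suc k) - real k) * f z"
      using MVT2[of "real k" "real (Suc k)" F f] by auto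
    then show ?thesis using that f[of "real k" z] f[of z "real (Suc k)"] by auto
  qed
  have tele: "(\<Sum>k<n. F (real (Suc k)) - F (real k)) = F (real n) - F 0"
    using sum_lessThan_telescope[of "\<lambda>k. F (real k)" n] by simp
  have shift: "(\<Sum>j=1..n. f (real j)) = (\<Sum>k<n. f (real (Suc k)))"
    by (rule sum.reindex_bij_witness[of _ Suc "\<lambda>j. j - 1"]) auto
  show "F (real n) - F 0 \<le> (\<Sum>j=1..n. f (real j))"
    unfolding shift tele[symmetric] using step by (intro sum_mono) auto
  have "(\<Sum>k<n. f (real k)) \<le> F (real n) - F 0"
    unfolding tele[symmetric] using step by (intro sum_mono) auto
  moreover have "(\<Sum>k<n. f (real (Suc k))) - (\<Sum>k<n. f (real k)) = f (real n) - f 0"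
    using sum_lessThan_telescope[of "\<lambda>k. f (real k)" n] by (simp add: sum_subtractf)
  ultimately show "(\<Sum>j=1..n. f (real j)) \<le> F (real n) - F 0 + f (real n)"
    unfolding shift using f0 by linarith
qed

section \<open>Interaction of parallels in the same closed hemisphere\<close>

text \<open>
  The diagonal terms are \<open>x / 0 = 0\<close>. Up to the factor \<open>4 * (1 + 4 * m\<^sup>2)\<close> this is the interaction of distinct
  parallels on the same side of the equator, both sides taken together and the equator counted with each of them.
\<close>
definition same_side_sum :: "nat \<Rightarrow> real" where
  "same_side_sum m = (\<Sum>i=1..m. \<Sum>j=1..m. real i * real j / \<bar>real i ^ 2 - real j ^ 2\<bar>)"

text \<open>
  Partial fractions: \<open>2 * x * y / (x\<^sup>2 - y\<^sup>2) = x * (1 / (x - y) - 1 / (x + y))\<close>, and both sums over \<open>y\<close> are pieces of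
  the harmonic series.
\<close>
lemma sum_partial_fractions_harm:
  "2 * (\<Sum>j=1..n. real (Suc n) * real j / (real (Suc n) ^ 2 - real j ^ 2))
     = real (Suc n) * (harm n + harm (Suc n) - harm (2 * n + 1))"
proof -
  have "2 * (real (Suc n) * real j / (real (Suc n) ^ 2 - real j ^ 2))
      = real (Suc n) * (inverse (real (Suc n - j)) - inverse (real (Suc n + j)))"
    if "j \<in> {1..n}" for j
  proof -
    define x where "x = real (Suc n)"
    define y where "y = real j"
    have xy: "x - y > 0" "x + y > 0" using that by (auto simp: x_def y_def)
    have "x ^ 2 - y ^ 2 = (x - y) * (x + y)" by (simp add: power2_eq_square algebra_simps)
    then have "2 * (x * y / (x ^ 2 - y ^ 2)) = x * (inverse (x - y) - inverse (x + y))"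
      using xy by (simp add: field_simps)
    moreover have "real (Suc n - j) = x - y" "real (Suc n + j) = x + y"
      using that by (auto simp: x_def y_def of_nat_diff)
    ultimately show ?thesis by (simp add: x_def y_def)
  qed
  then have "2 * (\<Sum>j=1..n. real (Suc n) * real j / (real (Suc n) ^ 2 - real j ^ 2))
      = real (Suc n) * ((\<Sum>j=1..n. inverse (real (Suc n - j))) - (\<Sum>j=1..n. inverse (real (Suc n + j))))"
    by (simp add: sum_distrib_left sum_subtractf right_diff_distrib)
  also have "(\<Sum>j=1..n. inverse (real (Suc n - j))) = harm n"
    unfolding harm_def
    by (rule sum.reindex_bij_witness[of _ "\<lambda>j. Suc n - j" "\<lambda>j. Suc n - j"]) auto
  also have "(\<Sum>j=1..n. inverse (real (Suc n + j))) = harm (2 * n + 1) - harm (Suc n)"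
  proof -
    have "harm (Suc n + k) = (harm (Suc n) :: real) + (\<Sum>j=1..k. inverse (real (Suc n + j)))" for k
      by (induction k) (auto simp: harm_Suc)
    from this[of n] show ?thesis by (simp add: mult_2)
  qed
  finally show ?thesis by (simp add: algebra_simps)
qed

lemma same_side_sum_Suc:
  "same_side_sum (Suc n) = same_side_sum n
     + 2 * (\<Sum>j=1..n. real j * real (Suc n) / (real (Suc n) ^ 2 - real j ^ 2))"
proof -
  let ?g = "\<lambda>i j. real i * real j / \<bar>real i ^ 2 - real j ^ 2\<bar>"
  have "same_side_sum (Suc n) = same_side_sum n + (\<Sum>j=1..n. ?g (Suc n) j) + (\<Sum>j=1..n. ?g j (Suc n))"
    unfolding same_side_sum_def by (simp add: sum.distrib)
  also have "(\<Sum>j=1..n. ?g j (Suc n)) = (\<Sum>j=1..n. ?g (Suc n) j)"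
    by (simp add: abs_minus_commute mult.commute)
  also have "(\<Sum>j=1..n. ?g (Suc n) j) = (\<Sum>j=1..n. real j * real (Suc n) / (real (Suc n) ^ 2 - real j ^ 2))"
  proof (intro sum.cong refl)
    fix j assume "j \<in> {1..n}"
    then have "real j ^ 2 \<le> real (Suc n) ^ 2" by (intro power_mono) auto
    then show "?g (Suc n) j = real j * real (Suc n) / (real (Suc n) ^ 2 - real j ^ 2)"
      by (simp add: mult.commute)
  qed
  finally show ?thesis by simp
qed

lemma same_side_sum_eq_harm:
  "same_side_sum n = (\<Sum>k<n. real (Suc k) * (harm k + harm (Suc k) - harm (2 * k + 1)))"
proof (induction n)
  case (Suc n)
  then show ?case
    unfolding same_side_sum_Suc sum.lessThan_Suc sum_partial_fractions_harm[symmetric]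
    by (simp add: mult.commute)
qed (simp add: same_side_sum_def)

lemma harm_combination_asymp:
  "(\<lambda>k. harm k + harm (Suc k) - harm (2 * k + 1) - ln (real (Suc k))) \<longlonglongrightarrow> euler_mascheroni - ln 2"
proof -
  define e where "e n = harm n - ln (real n)" for n
  have e: "e \<longlonglongrightarrow> euler_mascheroni"
    using euler_mascheroni_LIMSEQ by (simp add: e_def [abs_def])
  have e1: "(\<lambda>k. e (Suc k)) \<longlonglongrightarrow> euler_mascheroni" by (rule LIMSEQ_Suc[OF e])
  have e2: "(\<lambda>k. e (2 * Suc k)) \<longlonglongrightarrow> euler_mascheroni"
    by (rule filterlim_compose[OF e]) (intro filterlim_subseq, auto simp: strict_mono_def)
  have "(\<lambda>k. 2 * e (Suc k) - e (2 * Suc k) - ln 2 - 1 / (2 * real (Suc k)))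
      \<longlonglongrightarrow> 2 * euler_mascheroni - euler_mascheroni - ln 2 - 0"
    by (intro tendsto_intros e1 e2) real_asymp
  moreover have "harm k + harm (Suc k) - harm (2 * k + 1) - ln (real (Suc k))
      = 2 * e (Suc k) - e (2 * Suc k) - ln 2 - 1 / (2 * real (Suc k))" for k
  proof -
    have "ln (real (2 * Suc k)) = ln 2 + ln (real (Suc k))"
      unfolding of_nat_mult by (subst ln_mult) auto
    moreover have "harm (2 * Suc k) = (harm (2 * k + 1) :: real) + 1 / (2 * real (Suc k))"
      using harm_Suc[of "2 * k + 1", where 'a = real] by (simp add: field_simps)
    moreover have "harm (Suc k) = (harm k :: real) + 2 * (1 / (2 * real (Suc k)))"
      by (simp add: harm_Suc inverse_eq_divide del: of_nat_Suc)
    moreover have "h + h' - g - L = 2 * (h' - L) - (g' - L') - l - t"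
      if "L' = l + L" "g' = g + t" "h' = h + 2 * t" for h h' g g' L L' l t :: real
      using that by simp
    ultimately show ?thesis unfolding e_def by blast
  qed
  ultimately show ?thesis by simp
qed

text \<open>
  The increments of \<open>same_side_sum\<close> are \<open>k * (ln k + euler_mascheroni - ln 2) + o(k)\<close>, and so are those of the
  elementary function \<open>g\<close> below; the difference is then negligible against \<open>m\<^sup>2\<close>.
  This is the source of the logarithmic main term and of the Euler-Mascheroni constant.
\<close>
lemma same_side_sum_asymp:
  "(\<lambda>m. same_side_sum m / real m ^ 2 - ln (real m) / 2) \<longlonglongrightarrow> - 1 / 4 + (euler_mascheroni - ln 2) / 2"
proof -
  define c :: real where "c = euler_mascheroni - ln 2"
  \<comment> \<open>A primitive of \<open>x * ln x + c * x\<close>.\<close>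
  define g where "g x = x ^ 2 / 2 * ln x - x ^ 2 / 4 + c * x ^ 2 / 2" for x :: real
  define d where "d k = real (Suc k) * (harm k + harm (Suc k) - harm (2 * k + 1))
    - (g (real (Suc k)) - g (real k))" for k
  have "(\<lambda>k. (g (real (Suc k)) - g (real k)) / real (Suc k) - ln (real (Suc k))) \<longlonglongrightarrow> c"
    unfolding g_def by real_asymp
  with harm_combination_asymp
  have "(\<lambda>k. (harm k + harm (Suc k) - harm (2 * k + 1) - ln (real (Suc k)))
      - ((g (real (Suc k)) - g (real k)) / real (Suc k) - ln (real (Suc k)))) \<longlonglongrightarrow> c - c"
    unfolding c_def by (rule tendsto_diff)
  moreover have "(harm k + harm (Suc k) - harm (2 * k + 1) - ln (real (Suc k)))
      - ((g (real (Suc k)) - g (real k)) / real (Suc k) - ln (real (Suc k))) = d k / real (Suc k)" for k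
    by (simp add: d_def diff_divide_distrib del: of_nat_Suc)
  ultimately have "(\<lambda>n. (\<Sum>k<n. d k) / real n ^ 2) \<longlonglongrightarrow> 0"
    by (intro cesaro_linear_null) simp
  moreover have "(\<Sum>k<n. d k) = same_side_sum n - g (real n)" for n
    using sum_lessThan_telescope[of "\<lambda>k. g (real k)" n]
    by (simp add: d_def sum_subtractf same_side_sum_eq_harm g_def del: of_nat_Suc)
  ultimately have 1: "(\<lambda>n. (same_side_sum n - g (real n)) / real n ^ 2) \<longlonglongrightarrow> 0" by simp
  have 2: "(\<lambda>n. g (real n) / real n ^ 2 - ln (real n) / 2) \<longlonglongrightarrow> - 1 / 4 + c / 2"
    unfolding g_def by real_asymp
  have "(\<lambda>n. (same_side_sum n - g (real n)) / real n ^ 2 + (g (real n) / real n ^ 2 - ln (real n) / 2))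
      \<longlonglongrightarrow> 0 + (- 1 / 4 + c / 2)"
    by (rule tendsto_add[OF 1 2])
  then show ?thesis by (simp add: c_def diff_divide_distrib)
qed

section \<open>Interaction of parallels in opposite hemispheres\<close>

definition opposite_side_sum :: "nat \<Rightarrow> real" where
  "opposite_side_sum m = (\<Sum>i=1..<m. \<Sum>j=1..<m. real i * real j / (2 * real m ^ 2 - real i ^ 2 - real j ^ 2))"

text \<open>
  The inner sum is compared with its integral over \<open>j\<close>, a difference of logarithms.
  The hypothesis keeps the denominator positive on the range of integration.
\<close>
lemma opposite_inner_bounds:
  fixes x c :: real and n :: nat
  assumes x: "0 \<le> x" and c: "x ^ 2 + real n ^ 2 < c"
  defines "I \<equiv> x / 2 * (ln (c - x ^ 2) - ln (c - real n ^ 2 - x ^ 2))"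
  shows "I \<le> (\<Sum>j=1..n. x * real j / (c - x ^ 2 - real j ^ 2))"
    and "(\<Sum>j=1..n. x * real j / (c - x ^ 2 - real j ^ 2)) \<le> I + x * real n / (c - x ^ 2 - real n ^ 2)"
proof -
  define F where "F t = - x / 2 * ln (c - x ^ 2 - t ^ 2)" for t :: real
  define f where "f t = x * t / (c - x ^ 2 - t ^ 2)" for t :: real
  have pos: "c - x ^ 2 - t ^ 2 > 0" if "0 \<le> t" "t \<le> real n" for t :: real
    using power_mono[OF that(2,1), of 2] c by linarith
  have D: "(F has_real_derivative f t) (at t)" if t: "0 \<le> t" "t \<le> real n" for t :: real
    unfolding F_def f_def using pos[OF t]
    by (auto intro!: derivative_eq_intros simp: field_simps)
  have mono: "f s \<le> f t" if st: "0 \<le> s" "s \<le> t" "t \<le> real n" for s t :: real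
    unfolding f_def using pos[of s] pos[of t] st x power_mono[OF st(2,1), of 2]
    by (intro frac_le mult_left_mono) auto
  have I: "F (real n) - F 0 = I"
    by (simp add: F_def I_def algebra_simps)
  show "I \<le> (\<Sum>j=1..n. x * real j / (c - x ^ 2 - real j ^ 2))"
    using monotone_sum_integral_bounds(1)[of n F f, OF D mono] by (simp add: I f_def)
  show "(\<Sum>j=1..n. x * real j / (c - x ^ 2 - real j ^ 2)) \<le> I + x * real n / (c - x ^ 2 - real n ^ 2)"
    using monotone_sum_integral_bounds(2)[of n F f, OF D mono] by (simp add: I f_def)
qed

text \<open>
  \<open>I x\<close> is the value of the inner integral and increases with \<open>x\<close>, so its sum can be compared with the integral
  \<open>\<Psi>\<close>, built from the primitive \<open>u * (ln u - 1)\<close> of \<open>ln u\<close>.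
\<close>
lemma opposite_outer_bounds:
  fixes n :: nat and c :: real
  assumes c: "2 * real n ^ 2 < c"
  defines "I \<equiv> \<lambda>x. x / 2 * (ln (c - x ^ 2) - ln (c - real n ^ 2 - x ^ 2))"
    and "\<Psi> \<equiv> \<lambda>x. ((c - real n ^ 2 - x ^ 2) * (ln (c - real n ^ 2 - x ^ 2) - 1)
                   - (c - x ^ 2) * (ln (c - x ^ 2) - 1)) / 4"
  shows "\<Psi> (real n) - \<Psi> 0 \<le> (\<Sum>i=1..n. I (real i))"
    and "(\<Sum>i=1..n. I (real i)) \<le> \<Psi> (real n) - \<Psi> 0 + I (real n)"
proof -
  have pos: "c - real n ^ 2 - x ^ 2 > 0" "c - x ^ 2 > 0" if "0 \<le> x" "x \<le> real n" for x :: real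
    using power_mono[OF that(2,1), of 2] c zero_le_power2[of "real n"] by linarith+
  have D: "(\<Psi> has_real_derivative I x) (at x)" if "0 \<le> x" "x \<le> real n" for x :: real
  proof -
    have xlnx: "((\<lambda>x. (k - x ^ 2) * (ln (k - x ^ 2) - 1)) has_real_derivative - 2 * x * ln (k - x ^ 2)) (at x)"
      if "k - x ^ 2 > 0" for k
      using that by (auto intro!: derivative_eq_intros simp: divide_simps) (simp add: algebra_simps)
    have "(\<Psi> has_real_derivative
        (- 2 * x * ln (c - real n ^ 2 - x ^ 2) - (- 2 * x * ln (c - x ^ 2))) / 4) (at x)"
      unfolding \<Psi>_def by (intro DERIV_cdivide DERIV_diff xlnx pos that)
    moreover have "(- 2 * x * ln (c - real n ^ 2 - x ^ 2) - (- 2 * x * ln (c - x ^ 2))) / 4 = I x"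
      by (simp add: I_def field_simps)
    ultimately show ?thesis by simp
  qed
  have mono: "I x \<le> I y" if xy: "0 \<le> x" "x \<le> y" "y \<le> real n" for x y :: real
  proof -
    define v where "v t = c - real n ^ 2 - t ^ 2" for t :: real
    have L: "ln (c - t ^ 2) - ln (v t) = ln (1 + real n ^ 2 / v t)" if "0 \<le> t" "t \<le> real n" for t :: real
    proof -
      have "1 + real n ^ 2 / v t = (c - t ^ 2) / v t" using pos[OF that] by (simp add: v_def field_simps)
      then show ?thesis using pos[OF that] by (simp add: v_def ln_div)
    qed
    have v: "v y > 0" "v y \<le> v x" using pos[of y] xy power_mono[OF xy(2,1), of 2] by (auto simp: v_def)
    have "ln (1 + real n ^ 2 / v x) \<le> ln (1 + real n ^ 2 / v y)"
      using v by (intro ln_mono add_left_mono divide_left_mono) (auto intro!: add_pos_nonneg)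
    moreover have "0 \<le> ln (1 + real n ^ 2 / v x)" using v by (intro ln_ge_zero) auto
    ultimately have "x / 2 * ln (1 + real n ^ 2 / v x) \<le> y / 2 * ln (1 + real n ^ 2 / v y)"
      using xy by (intro mult_mono) auto
    then show ?thesis using L[of x] L[of y] xy by (simp add: I_def v_def)
  qed
  show "\<Psi> (real n) - \<Psi> 0 \<le> (\<Sum>i=1..n. I (real i))"
    by (rule monotone_sum_integral_bounds(1)[OF D mono]) (auto simp: I_def)
  show "(\<Sum>i=1..n. I (real i)) \<le> \<Psi> (real n) - \<Psi> 0 + I (real n)"
    by (rule monotone_sum_integral_bounds(2)[OF D mono]) (auto simp: I_def)
qed

text \<open>
  Divided by \<open>m\<^sup>2\<close> this is a Riemann sum for \<open>\<integral>\<integral> x * y / (2 - x\<^sup>2 - y\<^sup>2)\<close> over the unit square, whose value is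
  \<open>ln 2 / 2\<close>. The integrand is unbounded near the corner \<open>(1, 1)\<close>, but it increases in both variables, and the
  error terms of the monotone comparison are only \<open>O(m * ln m)\<close>.
\<close>
lemma opposite_side_sum_asymp:
  "(\<lambda>m. opposite_side_sum m / real m ^ 2) \<longlonglongrightarrow> ln 2 / 2"
proof (rule LIMSEQ_imp_Suc)
  define c where "c n = 2 * (real n + 1) ^ 2" for n :: nat
  define I where "I n x = x / 2 * (ln (c n - x ^ 2) - ln (c n - real n ^ 2 - x ^ 2))" for n and x :: real
  define \<Psi> where "\<Psi> n x = ((c n - real n ^ 2 - x ^ 2) * (ln (c n - real n ^ 2 - x ^ 2) - 1)
                   - (c n - x ^ 2) * (ln (c n - x ^ 2) - 1)) / 4" for n and x :: real
  have c: "2 * real n ^ 2 < c n" for n by (simp add: c_def power2_eq_square algebra_simps)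
  have S: "opposite_side_sum (Suc n) = (\<Sum>i=1..n. \<Sum>j=1..n. real i * real j / (c n - real i ^ 2 - real j ^ 2))" for n
    by (simp add: opposite_side_sum_def c_def atLeastLessThanSuc_atLeastAtMost add.commute)
  have c': "real i ^ 2 + real n ^ 2 < c n" if "i \<le> n" for i n
  proof -
    have "real i ^ 2 \<le> real n ^ 2" using that by (intro power_mono) auto
    then show ?thesis using c[of n] by linarith
  qed
  have lower: "\<Psi> n (real n) - \<Psi> n 0 \<le> opposite_side_sum (Suc n)" for n
  proof -
    have "\<Psi> n (real n) - \<Psi> n 0 \<le> (\<Sum>i=1..n. I n (real i))"
      unfolding \<Psi>_def I_def by (rule opposite_outer_bounds[OF c])
    also have "\<dots> \<le> opposite_side_sum (Suc n)"
      unfolding S I_def by (intro sum_mono opposite_inner_bounds c') auto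
    finally show ?thesis .
  qed
  have upper: "opposite_side_sum (Suc n) \<le> \<Psi> n (real n) - \<Psi> n 0 + 2 * I n (real n) + real n ^ 2 / (c n - 2 * real n ^ 2)" for n
  proof -
    have "opposite_side_sum (Suc n) \<le> (\<Sum>i=1..n. I n (real i) + real i * real n / (c n - real i ^ 2 - real n ^ 2))"
      unfolding S I_def by (intro sum_mono opposite_inner_bounds c') auto
    also have "\<dots> = (\<Sum>i=1..n. I n (real i)) + (\<Sum>i=1..n. real n * real i / (c n - real n ^ 2 - real i ^ 2))"
      by (simp add: sum.distrib algebra_simps)
    also have "(\<Sum>i=1..n. I n (real i)) \<le> \<Psi> n (real n) - \<Psi> n 0 + I n (real n)"
      unfolding \<Psi>_def I_def by (rule opposite_outer_bounds[OF c])
    \<comment> \<open>The accumulated error terms form the inner sum with \<open>x = n\<close>, so the same bound applies once more.\<close>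
    also have "(\<Sum>i=1..n. real n * real i / (c n - real n ^ 2 - real i ^ 2))
        \<le> I n (real n) + real n * real n / (c n - real n ^ 2 - real n ^ 2)"
      unfolding I_def by (intro opposite_inner_bounds c') auto
    finally show ?thesis by (simp add: power2_eq_square algebra_simps)
  qed
  show "(\<lambda>n. opposite_side_sum (Suc n) / real (Suc n) ^ 2) \<longlonglongrightarrow> ln 2 / 2"
  proof (rule tendsto_sandwich)
    show "\<forall>\<^sub>F n in sequentially. (\<Psi> n (real n) - \<Psi> n 0) / real (Suc n) ^ 2 \<le> opposite_side_sum (Suc n) / real (Suc n) ^ 2"
      by (intro always_eventually allI divide_right_mono lower) auto
    show "\<forall>\<^sub>F n in sequentially. opposite_side_sum (Suc n) / real (Suc n) ^ 2 \<le>
        (\<Psi> n (real n) - \<Psi> n 0 + 2 * I n (real n) + real n ^ 2 / (c n - 2 * real n ^ 2)) / real (Suc n) ^ 2"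
      by (intro always_eventually allI divide_right_mono upper) auto
    show "(\<lambda>n. (\<Psi> n (real n) - \<Psi> n 0) / real (Suc n) ^ 2) \<longlonglongrightarrow> ln 2 / 2"
    proof -
      have "(\<lambda>n. (\<Psi> n (real n) - \<Psi> n 0) / real (Suc n) ^ 2) \<longlonglongrightarrow> 1 / 4 - (1 - 2 * ln 2) / 4"
        unfolding \<Psi>_def c_def by real_asymp
      then show ?thesis by (simp add: field_simps)
    qed
    show "(\<lambda>n. (\<Psi> n (real n) - \<Psi> n 0 + 2 * I n (real n) + real n ^ 2 / (c n - 2 * real n ^ 2)) / real (Suc n) ^ 2) \<longlonglongrightarrow> ln 2 / 2"
    proof -
      have "(\<lambda>n. (\<Psi> n (real n) - \<Psi> n 0 + 2 * I n (real n) + real n ^ 2 / (c n - 2 * real n ^ 2)) / real (Suc n) ^ 2)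
          \<longlonglongrightarrow> 1 / 4 - (1 - 2 * ln 2) / 4"
        unfolding \<Psi>_def I_def c_def by real_asymp
      then show ?thesis by (simp add: field_simps)
    qed
  qed
qed

section \<open>Numerical value of the constant\<close>

lemma ln2_bounds: "ln (2::real) \<in> {693147 / 1000000<..<693148 / 1000000}"
  using ln_approx_bounds[of 2 6] by (simp add: eval_nat_numeral)

lemma diamond_const_bounds: "- 0.0770 < diamond_const" "diamond_const \<le> - 0.0769"
proof -
  \<comment> \<open>\<open>n = 127\<close> puts a power of \<open>2\<close> into the logarithm and gives an error below \<open>1 / 32000\<close>, just enough for the upper bound.\<close>
  have ln128: "ln (real (Suc 127)) = 7 * ln 2"
  proof -
    have "ln (real (Suc 127)) = ln (2 ^ 7)" by simp
    also have "\<dots> = 7 * ln 2" by (subst ln_realpow) auto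
    finally show ?thesis .
  qed
  have h: "harm 127 \<in> {5425334/1000000..5425335/(1000000::real)}" by (simp add: harm_expand)
  have b: "euler_mascheroni \<in> {harm 127 - 7 * ln 2 + inverse (of_nat (2 * (127 + 1)))..
      harm 127 - 7 * ln 2 + inverse (of_nat (2 * 127)) :: real}"
    using euler_mascheroni_bounds[of 127] unfolding ln128 by simp
  show "- 0.0770 < diamond_const" "diamond_const \<le> - 0.0769"
    using b h ln2_bounds by (simp_all add: diamond_const_def)
qed

section \<open>Reduction of the expected energy to sums over the northern parallels\<close>

text \<open>
  This is \<open>r * (r\<^sup>2 - 1) / (12 * (1 - h\<^sup>2))\<close> for \<open>r = 4 * j\<close>, divided by \<open>(1 + 4 * m\<^sup>2)\<^sup>2\<close> so that only
  elementary functions of \<open>j\<close> and \<open>m\<close> remain.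
\<close>
definition parallel_self_energy :: "nat \<Rightarrow> nat \<Rightarrow> real" where
  "parallel_self_energy m j = real j * (16 * real j ^ 2 - 1)
     / (3 * (1 + 4 * real j ^ 2) * (1 + 8 * real m ^ 2 - 4 * real j ^ 2))"

text \<open>
  The expected interaction of a parallel with both poles, normalised in the same way.
\<close>
definition pole_parallel_energy :: "nat \<Rightarrow> nat \<Rightarrow> real" where
  "pole_parallel_energy m j = 4 * real j / ((1 + 4 * real j ^ 2) * (1 + 8 * real m ^ 2 - 4 * real j ^ 2))"

lemma one_minus_ring_height_square:
  assumes "1 \<le> j" "j \<le> m"
  shows "1 - (ring_height m j)\<^sup>2
           = (1 + 4 * real j ^ 2) * (1 + 8 * real m ^ 2 - 4 * real j ^ 2) / (1 + 4 * real m ^ 2) ^ 2"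
proof -
  have "1 + 4 * real m ^ 2 > 0" by (simp add: add_pos_nonneg)
  then show ?thesis
    unfolding ring_height_north[OF assms]
    by (simp add: power_divide divide_simps) (simp add: power2_eq_square algebra_simps)
qed

lemma interior_ring_size:
  assumes "1 \<le> j" "j \<le> m"
  shows "ring_size m j = 4 * j" "ring_size m (2 * m - j) = 4 * j"
  using assms by (auto simp: ring_size_def diamond_r_def)

lemma ring_pair_energy_reflect:
  assumes "m \<ge> 1" "i \<le> 2 * m" "j \<le> 2 * m"
  shows "ring_pair_energy m (2 * m - i) (2 * m - j) = ring_pair_energy m i j"
proof -
  have "ring_size m (2 * m - k) = ring_size m k" if "k \<le> 2 * m" for k
    using that assms(1) by (auto simp: ring_size_def diamond_r_reflect)
  moreover have "2 * m - i = 2 * m - j \<longleftrightarrow> i = j" using assms by auto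
  ultimately show ?thesis
    unfolding ring_pair_energy_def using assms by (simp add: ring_height_reflect abs_minus_commute)
qed

lemma ring_pair_energy_commute: "ring_pair_energy m i j = ring_pair_energy m j i"
  by (simp add: ring_pair_energy_def abs_minus_commute mult.commute)

lemma ring_pair_energy_self:
  assumes "1 \<le> j" "j \<le> m"
  shows "ring_pair_energy m j j = (1 + 4 * real m ^ 2) ^ 2 * parallel_self_energy m j"
  using one_minus_ring_height_square[OF assms] interior_ring_size[OF assms]
  by (simp add: ring_pair_energy_def parallel_self_energy_def) (simp add: algebra_simps power2_eq_square)

lemma ring_pair_energy_poles:
  assumes m: "1 \<le> j" "j \<le> m"
  shows "ring_pair_energy m 0 j + ring_pair_energy m (2 * m) j = (1 + 4 * real m ^ 2) ^ 2 * pole_parallel_energy m j"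
proof -
  have m1: "m \<ge> 1" using m by simp
  have h: "\<bar>ring_height m j\<bar> < 1" using m by (intro abs_ring_height_less) auto
  have "\<bar>1 - ring_height m j\<bar> = 1 - ring_height m j" "\<bar>- 1 - ring_height m j\<bar> = 1 + ring_height m j"
    using h by auto
  then have "ring_pair_energy m 0 j = real (4 * j) / (2 * (1 - ring_height m j))"
    "ring_pair_energy m (2 * m) j = real (4 * j) / (2 * (1 + ring_height m j))"
    using m interior_ring_size[OF m]
    by (auto simp: ring_pair_energy_def ring_size_def[of _ 0] ring_size_def[of _ "2 * m"]
        ring_height_def[of _ 0] ring_height_def[of _ "2 * m"])
  then have "ring_pair_energy m 0 j + ring_pair_energy m (2 * m) j
      = real (4 * j) / (2 * (1 - ring_height m j)) + real (4 * j) / (2 * (1 + ring_height m j))"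
    by (simp only:)
  also have "\<dots> = real (4 * j) / (1 - (ring_height m j)\<^sup>2)"
  proof -
    have "1 - ring_height m j > 0" "1 + ring_height m j > 0" using h by auto
    moreover have "1 - (ring_height m j)\<^sup>2 = (1 - ring_height m j) * (1 + ring_height m j)"
      by (simp add: power2_eq_square algebra_simps)
    ultimately show ?thesis by (simp add: divide_simps) (simp add: algebra_simps)
  qed
  finally show ?thesis
    unfolding one_minus_ring_height_square[OF m] by (simp add: pole_parallel_energy_def)
qed

lemma ring_pair_energy_same_side:
  assumes "1 \<le> i" "i \<le> m" "1 \<le> j" "j \<le> m" "i \<noteq> j"
  shows "ring_pair_energy m i j
    = 2 * (1 + 4 * real m ^ 2) * (real i * real j / \<bar>real i ^ 2 - real j ^ 2\<bar>)"
proof -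
  have D: "1 + 4 * real m ^ 2 > 0" by (simp add: add_pos_nonneg)
  have "ring_height m i - ring_height m j = 4 * (real j ^ 2 - real i ^ 2) / (1 + 4 * real m ^ 2)"
    unfolding ring_height_north[OF assms(1,2)] ring_height_north[OF assms(3,4)] diff_divide_distrib[symmetric]
    by simp
  then have "\<bar>ring_height m i - ring_height m j\<bar> = 4 * \<bar>real i ^ 2 - real j ^ 2\<bar> / (1 + 4 * real m ^ 2)"
    using D by (simp only: abs_divide abs_mult) (simp add: abs_minus_commute)
  then show ?thesis
    using assms D by (simp add: ring_pair_energy_def interior_ring_size)
qed

lemma ring_pair_energy_opposite_side:
  assumes "1 \<le> i" "i < m" "1 \<le> j" "j < m"
  shows "ring_pair_energy m i (2 * m - j)
    = 2 * (1 + 4 * real m ^ 2) * (real i * real j / (2 * real m ^ 2 - real i ^ 2 - real j ^ 2))"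
proof -
  have D: "1 + 4 * real m ^ 2 > 0" by (simp add: add_pos_nonneg)
  define w where "w = 2 * real m ^ 2 - real i ^ 2 - real j ^ 2"
  have "real i ^ 2 < real m ^ 2" "real j ^ 2 < real m ^ 2"
    using assms by (auto intro!: power_strict_mono)
  then have pos: "w > 0" unfolding w_def by linarith
  have "ring_height m i - ring_height m (2 * m - j)
      = 4 * w / (1 + 4 * real m ^ 2)"
  proof -
    have "ring_height m (2 * m - j) = - ring_height m j"
      using assms by (intro ring_height_reflect) auto
    moreover have "ring_height m i + ring_height m j
        = 4 * w / (1 + 4 * real m ^ 2)"
      using assms by (simp add: ring_height_north w_def flip: add_divide_distrib)
    ultimately show ?thesis by simp
  qed
  then have "\<bar>ring_height m i - ring_height m (2 * m - j)\<bar>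
      = 4 * w / (1 + 4 * real m ^ 2)"
    using D pos by (simp add: abs_mult)
  moreover have "i \<noteq> 2 * m - j" using assms by auto
  ultimately show ?thesis
    using assms D unfolding w_def[symmetric] by (simp add: ring_pair_energy_def interior_ring_size)
qed

text \<open>
  Folding both indices at the equator turns the four sign combinations of a pair of parallels into two copies
  of a same-side pair and two copies of an opposite-side pair. The pairs that involve the equator are exactly what
  \<open>same_side_sum m\<close> has in addition to \<open>same_side_sum (m - 1)\<close>.
\<close>
lemma sum_parallel_pairs:
  assumes m: "m \<ge> 1"
  shows "(\<Sum>i=1..2*m-1. \<Sum>j=1..2*m-1. ring_pair_energy m i j)
    = (1 + 4 * real m ^ 2) ^ 2 * (2 * (\<Sum>j=1..<m. parallel_self_energy m j) + parallel_self_energy m m)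
      + 4 * (1 + 4 * real m ^ 2) * (same_side_sum m + opposite_side_sum m)"
proof -
  let ?e = "ring_pair_energy m" and ?D = "1 + 4 * real m ^ 2"
  let ?a = "\<lambda>i j. real i * real j / \<bar>real i ^ 2 - real j ^ 2\<bar>"
  let ?b = "\<lambda>i j. real i * real j / (2 * real m ^ 2 - real i ^ 2 - real j ^ 2)"
  obtain n where n: "m = Suc n" using m by (cases m) auto
  have refl1: "?e (2 * m - i) j = ?e i (2 * m - j)" if "i \<le> 2 * m" "j \<le> 2 * m" for i j
    using ring_pair_energy_reflect[OF m, of i "2 * m - j"] that by simp
  have refl2: "?e (2 * m - i) m = ?e i m" if "i \<le> 2 * m" for i
    using refl1[of i m] that by simp
  have near: "?e i j = (if i = j then ?D ^ 2 * parallel_self_energy m j else 0) + 2 * ?D * ?a i j"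
    if "1 \<le> i" "i \<le> m" "1 \<le> j" "j \<le> m" for i j
    using that ring_pair_energy_self[of j m] ring_pair_energy_same_side[of i m j] by (cases "i = j") auto
  have "(\<Sum>i=1..2*m-1. \<Sum>j=1..2*m-1. ?e i j)
      = (\<Sum>i=1..<m. (\<Sum>j=1..<m. 2 * ?e i j + 2 * ?e i (2 * m - j)) + 2 * ?e i m)
        + ((\<Sum>j=1..<m. 2 * ?e j m) + ?e m m)"
  proof -
    have "(\<Sum>j=1..2*m-1. ?e i j) + (\<Sum>j=1..2*m-1. ?e (2 * m - i) j)
        = (\<Sum>j=1..<m. 2 * ?e i j + 2 * ?e i (2 * m - j)) + 2 * ?e i m" if "i \<in> {1..<m}" for i
    proof -
      have "(\<Sum>j=1..2*m-1. ?e i j) + (\<Sum>j=1..2*m-1. ?e (2 * m - i) j)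
          = (\<Sum>j=1..<m. (?e i j + ?e i (2 * m - j)) + (?e (2 * m - i) j + ?e (2 * m - i) (2 * m - j)))
            + (?e i m + ?e (2 * m - i) m)"
        unfolding sum_over_parallels_fold[OF m] by (simp only: sum.distrib add_ac)
      also have "\<dots> = (\<Sum>j=1..<m. 2 * ?e i j + 2 * ?e i (2 * m - j)) + 2 * ?e i m"
        by (rule arg_cong2[where f = plus, OF sum.cong]) (use that in \<open>auto simp: refl1 refl2\<close>)
      finally show ?thesis .
    qed
    moreover have "(\<Sum>j=1..2*m-1. ?e m j) = (\<Sum>j=1..<m. 2 * ?e j m) + ?e m m"
    proof -
      have "?e m j = ?e j m" "?e m (2 * m - j) = ?e j m" if "j \<in> {1..<m}" for j
        using that refl2[of j] by (auto simp: ring_pair_energy_commute[of m m])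
      then show ?thesis unfolding sum_over_parallels_fold[OF m]
        by (intro arg_cong2[where f = plus] sum.cong) auto
    qed
    ultimately show ?thesis
      unfolding sum_over_parallels_fold[OF m, of "\<lambda>i. \<Sum>j=1..2*m-1. ?e i j"]
      by - (rule arg_cong2[where f = plus, OF sum.cong], auto)
  qed
  also have "\<dots> = 2 * (\<Sum>i=1..<m. \<Sum>j=1..<m. ?e i j) + 2 * (\<Sum>i=1..<m. \<Sum>j=1..<m. ?e i (2 * m - j))
      + 4 * (\<Sum>i=1..<m. ?e i m) + ?e m m"
    by (simp add: sum.distrib sum_distrib_left algebra_simps)
  also have "(\<Sum>i=1..<m. \<Sum>j=1..<m. ?e i j)
      = ?D ^ 2 * (\<Sum>j=1..<m. parallel_self_energy m j) + 2 * ?D * same_side_sum n"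
  proof -
    have "(\<Sum>i=1..<m. \<Sum>j=1..<m. ?e i j)
        = (\<Sum>i=1..<m. \<Sum>j=1..<m. (if i = j then ?D ^ 2 * parallel_self_energy m j else 0) + 2 * ?D * ?a i j)"
      by (intro sum.cong refl near) auto
    also have "\<dots> = (\<Sum>i=1..<m. ?D ^ 2 * parallel_self_energy m i) + 2 * ?D * (\<Sum>i=1..<m. \<Sum>j=1..<m. ?a i j)"
      by (simp add: sum.distrib sum_distrib_left)
    also have "(\<Sum>i=1..<m. \<Sum>j=1..<m. ?a i j) = same_side_sum n"
      by (simp add: same_side_sum_def n atLeastLessThanSuc_atLeastAtMost)
    finally show ?thesis by (simp add: sum_distrib_left)
  qed
  also have "(\<Sum>i=1..<m. \<Sum>j=1..<m. ?e i (2 * m - j)) = 2 * ?D * opposite_side_sum m"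
    unfolding opposite_side_sum_def sum_distrib_left
    by (intro sum.cong refl ring_pair_energy_opposite_side) auto
  also have "(\<Sum>i=1..<m. ?e i m) = 2 * ?D * (\<Sum>i=1..n. real i * real m / (real m ^ 2 - real i ^ 2))"
  proof -
    have "(\<Sum>i=1..<m. ?e i m) = (\<Sum>i=1..<m. 2 * ?D * (real i * real m / (real m ^ 2 - real i ^ 2)))"
    proof (intro sum.cong refl)
      fix i assume i: "i \<in> {1..<m}"
      then have "real i ^ 2 < real m ^ 2" by (intro power_strict_mono) auto
      then show "?e i m = 2 * ?D * (real i * real m / (real m ^ 2 - real i ^ 2))"
        using i ring_pair_energy_same_side[of i m m] by simp
    qed
    then show ?thesis by (simp add: sum_distrib_left n atLeastLessThanSuc_atLeastAtMost)
  qed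
  also have "?e m m = ?D ^ 2 * parallel_self_energy m m"
    using m by (intro ring_pair_energy_self) auto
  finally have "(\<Sum>i=1..2*m-1. \<Sum>j=1..2*m-1. ?e i j)
      = 2 * (?D ^ 2 * (\<Sum>j=1..<m. parallel_self_energy m j) + 2 * ?D * same_side_sum n)
        + 2 * (2 * ?D * opposite_side_sum m)
        + 4 * (2 * ?D * (\<Sum>i=1..n. real i * real m / (real m ^ 2 - real i ^ 2)))
        + ?D ^ 2 * parallel_self_energy m m" .
  moreover have "same_side_sum m = same_side_sum n + 2 * (\<Sum>i=1..n. real i * real m / (real m ^ 2 - real i ^ 2))"
    unfolding n by (rule same_side_sum_Suc)
  ultimately show ?thesis by (simp add: algebra_simps)
qed

lemma sum_all_ring_pairs:
  assumes m: "m \<ge> 1"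
  shows "(\<Sum>i=0..2*m. \<Sum>j=0..2*m. ring_pair_energy m i j)
    = (1 + 4 * real m ^ 2) ^ 2 * (2 * (\<Sum>j=1..<m. parallel_self_energy m j) + parallel_self_energy m m)
      + 2 * (1 + 4 * real m ^ 2) ^ 2 * (2 * (\<Sum>j=1..<m. pole_parallel_energy m j) + pole_parallel_energy m m)
      + 1 / 2
      + 4 * (1 + 4 * real m ^ 2) * (same_side_sum m + opposite_side_sum m)"
proof -
  let ?e = "ring_pair_energy m" and ?D = "1 + 4 * real m ^ 2"
  let ?J = "{1..2 * m - 1}"
  have split: "(\<Sum>i=0..2*m. f i) = f 0 + f (2 * m) + sum f ?J" for f :: "nat \<Rightarrow> real"
    unfolding ring_split[OF m] using m by (subst sum.union_disjoint) auto
  have "(\<Sum>i=0..2*m. \<Sum>j=0..2*m. ?e i j)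
      = (?e 0 0 + ?e 0 (2 * m) + ?e (2 * m) 0 + ?e (2 * m) (2 * m))
        + 2 * (\<Sum>j\<in>?J. ?e 0 j + ?e (2 * m) j) + (\<Sum>i\<in>?J. \<Sum>j\<in>?J. ?e i j)"
  proof -
    have "(\<Sum>i\<in>?J. ?e i 0 + ?e i (2 * m)) = (\<Sum>j\<in>?J. ?e 0 j + ?e (2 * m) j)"
      by (intro sum.cong refl arg_cong2[where f = plus] ring_pair_energy_commute)
    then show ?thesis unfolding split by (simp add: sum.distrib)
  qed
  also have "?e 0 0 + ?e 0 (2 * m) + ?e (2 * m) 0 + ?e (2 * m) (2 * m) = 1 / 2"
    using m by (simp add: ring_pair_energy_def ring_size_def ring_height_def)
  also have "(\<Sum>j\<in>?J. ?e 0 j + ?e (2 * m) j)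
      = ?D ^ 2 * (2 * (\<Sum>j=1..<m. pole_parallel_energy m j) + pole_parallel_energy m m)"
  proof -
    have "?e 0 (2 * m - j) + ?e (2 * m) (2 * m - j) = ?e 0 j + ?e (2 * m) j" if "j \<le> m" for j
      using ring_pair_energy_reflect[OF m, of "2 * m" j] ring_pair_energy_reflect[OF m, of 0 j] that by simp
    then have "(\<Sum>j\<in>?J. ?e 0 j + ?e (2 * m) j) = (\<Sum>j=1..<m. 2 * (?e 0 j + ?e (2 * m) j)) + (?e 0 m + ?e (2 * m) m)"
      unfolding sum_over_parallels_fold[OF m]
      by (intro arg_cong2[where f = plus] sum.cong refl) auto
    also have "\<dots> = (\<Sum>j=1..<m. 2 * (?D ^ 2 * pole_parallel_energy m j)) + ?D ^ 2 * pole_parallel_energy m m"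
      using m by (intro arg_cong2[where f = plus] sum.cong refl arg_cong2[where f = times] ring_pair_energy_poles) auto
    finally show ?thesis by (simp add: distrib_left distrib_right sum_distrib_left sum_distrib_right mult_ac)
  qed
  also have "(\<Sum>i\<in>?J. \<Sum>j\<in>?J. ?e i j) = ?D ^ 2 * (2 * (\<Sum>j=1..<m. parallel_self_energy m j) + parallel_self_energy m m)
      + 4 * ?D * (same_side_sum m + opposite_side_sum m)"
    by (rule sum_parallel_pairs[OF m])
  finally show ?thesis by (simp add: algebra_simps)
qed

section \<open>Asymptotic evaluation\<close>

text \<open>
  The factor \<open>(16 * x\<^sup>2 - 1) / (3 * (1 + 4 * x\<^sup>2))\<close> of the self-energy is \<open>4 / 3\<close> up to a multiple of \<open>1 / (1 + 4 * x\<^sup>2)\<close>,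
  and that correction contributes \<open>5 / 12\<close> of the interaction with the poles. The latter is small uniformly in \<open>j\<close>
  because \<open>4 * x \<le> 1 + 4 * x\<^sup>2\<close>.
\<close>
lemma self_energy_near_profile:
  assumes "1 \<le> j" "j \<le> m"
  defines "q \<equiv> real j / (1 + 8 * real m ^ 2 - 4 * real j ^ 2)"
  shows "parallel_self_energy m j \<le> 4 / 3 * q"
    and "4 / 3 * q - 1 / (1 + 4 * real m ^ 2) \<le> parallel_self_energy m j"
    and "pole_parallel_energy m j \<in> {0..1 / (1 + 4 * real m ^ 2)}"
proof -
  define x where "x = real j"
  define w where "w = 1 + 8 * real m ^ 2 - 4 * x ^ 2"
  have "x ^ 2 \<le> real m ^ 2" using assms by (simp add: x_def power_mono)
  then have w: "w \<ge> 1 + 4 * real m ^ 2" "1 + 4 * real m ^ 2 > 0"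
    by (auto simp: w_def add_pos_nonneg)
  have x: "x \<ge> 1" using assms by (simp add: x_def)
  define v where "v = 1 + 4 * x ^ 2"
  have v: "v > 0" by (simp add: v_def add_pos_nonneg)
  have "0 \<le> (2 * x - 1) ^ 2" by simp
  then have amgm: "4 * x \<le> v" by (simp add: v_def power2_eq_square algebra_simps)
  have p: "pole_parallel_energy m j = (4 * x / v) * (1 / w)"
    by (simp add: pole_parallel_energy_def x_def w_def v_def)
  have ratio: "4 * x / v \<le> 1" "0 \<le> 4 * x / v"
    using amgm v x by (auto simp: divide_le_eq)
  have iw: "1 / w \<le> 1 / (1 + 4 * real m ^ 2)" "0 \<le> 1 / w" using w by (auto intro!: divide_left_mono)
  have "pole_parallel_energy m j \<le> 1 * (1 / (1 + 4 * real m ^ 2))"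
    unfolding p using ratio iw by (intro mult_mono) auto
  moreover have p0: "pole_parallel_energy m j \<ge> 0"
    unfolding p using ratio iw by (intro mult_nonneg_nonneg)
  ultimately show pole: "pole_parallel_energy m j \<in> {0..1 / (1 + 4 * real m ^ 2)}" by simp
  have "(16 * x ^ 2 - 1) / (3 * v) = 4 / 3 - 5 / (3 * v)"
    using v by (simp add: divide_simps) (simp add: v_def)
  moreover have "parallel_self_energy m j = (x / w) * ((16 * x ^ 2 - 1) / (3 * v))"
    by (simp add: parallel_self_energy_def x_def w_def v_def)
  moreover have "5 / 12 * pole_parallel_energy m j = (x / w) * (5 / (3 * v))"
    unfolding p by (simp add: mult_ac)
  moreover have "q = x / w" by (simp add: q_def x_def w_def)
  ultimately have "parallel_self_energy m j = 4 / 3 * q - 5 / 12 * pole_parallel_energy m j"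
    by (simp add: right_diff_distrib mult_ac)
  then show "parallel_self_energy m j \<le> 4 / 3 * q"
    and "4 / 3 * q - 1 / (1 + 4 * real m ^ 2) \<le> parallel_self_energy m j"
    using pole p0 by auto
qed

lemma pole_parallel_energy_asymp:
  "(\<lambda>m. 2 * (\<Sum>j=1..<m. pole_parallel_energy m j) + pole_parallel_energy m m) \<longlonglongrightarrow> 0"
proof (rule tendsto_sandwich)
  have b: "pole_parallel_energy m j \<in> {0..1 / (1 + 4 * real m ^ 2)}" if "1 \<le> j" "j \<le> m" for m j
    using that by (rule self_energy_near_profile)
  show "\<forall>\<^sub>F m in sequentially. 0 \<le> 2 * (\<Sum>j=1..<m. pole_parallel_energy m j) + pole_parallel_energy m m"
    using eventually_ge_at_top[of 1]
    by eventually_elim (use b in \<open>auto intro!: add_nonneg_nonneg mult_nonneg_nonneg sum_nonneg\<close>)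
  show "\<forall>\<^sub>F m in sequentially. 2 * (\<Sum>j=1..<m. pole_parallel_energy m j) + pole_parallel_energy m m
      \<le> 2 * (real m * (1 / (1 + 4 * real m ^ 2))) + 1 / (1 + 4 * real m ^ 2)"
    using eventually_ge_at_top[of 1]
  proof eventually_elim
    case (elim m)
    have "(\<Sum>j=1..<m. pole_parallel_energy m j) \<le> real (card {1..<m}) * (1 / (1 + 4 * real m ^ 2))"
      using b by (intro sum_bounded_above) auto
    also have "\<dots> \<le> real m * (1 / (1 + 4 * real m ^ 2))" by (intro mult_right_mono) auto
    finally show ?case using b[of m m] elim by auto
  qed
  show "(\<lambda>m. 2 * (real m * (1 / (1 + 4 * real m ^ 2))) + 1 / (1 + 4 * real m ^ 2)) \<longlonglongrightarrow> 0"
    by real_asymp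
qed simp

text \<open>
  The summand increases in \<open>j\<close> and has the primitive \<open>- ln (1 + 8 * m\<^sup>2 - 4 * t\<^sup>2) / 8\<close>. As \<open>m\<close> grows, both bounds
  tend to \<open>ln 2 / 8\<close>.
\<close>
lemma profile_sum_bounds:
  fixes m :: nat
  defines "\<Phi> \<equiv> ln ((1 + 8 * real m ^ 2) / (1 + 4 * real m ^ 2)) / 8"
  shows "\<Phi> \<le> (\<Sum>j=1..m. real j / (1 + 8 * real m ^ 2 - 4 * real j ^ 2))"
    and "(\<Sum>j=1..m. real j / (1 + 8 * real m ^ 2 - 4 * real j ^ 2)) \<le> \<Phi> + real m / (1 + 4 * real m ^ 2)"
proof -
  define F where "F t = - ln (1 + 8 * real m ^ 2 - 4 * t ^ 2) / 8" for t :: real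
  define f where "f t = t / (1 + 8 * real m ^ 2 - 4 * t ^ 2)" for t :: real
  have pos: "1 + 8 * real m ^ 2 - 4 * t ^ 2 > 0" if "0 \<le> t" "t \<le> real m" for t :: real
    using power_mono[OF that(2,1), of 2] zero_le_power2[of "real m"] by linarith
  have D: "(F has_real_derivative f t) (at t)" if t: "0 \<le> t" "t \<le> real m" for t :: real
    unfolding F_def f_def using pos[OF t]
    by (auto intro!: derivative_eq_intros simp: field_simps)
  have mono: "f s \<le> f t" if st: "0 \<le> s" "s \<le> t" "t \<le> real m" for s t :: real
    unfolding f_def using pos[of s] pos[of t] st power_mono[OF st(2,1), of 2]
    by (intro frac_le) auto
  have "0 < 1 + 8 * real m ^ 2" "0 < 1 + 4 * real m ^ 2" by (auto simp: add_pos_nonneg)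
  then have \<Phi>: "F (real m) - F 0 = \<Phi>"
    by (simp add: F_def \<Phi>_def ln_div diff_divide_distrib)
  have fm: "f (real m) = real m / (1 + 4 * real m ^ 2)" by (simp add: f_def add.commute)
  show "\<Phi> \<le> (\<Sum>j=1..m. real j / (1 + 8 * real m ^ 2 - 4 * real j ^ 2))"
    using monotone_sum_integral_bounds(1)[of m F f, OF D mono] by (simp add: \<Phi> f_def)
  show "(\<Sum>j=1..m. real j / (1 + 8 * real m ^ 2 - 4 * real j ^ 2)) \<le> \<Phi> + real m / (1 + 4 * real m ^ 2)"
    using monotone_sum_integral_bounds(2)[of m F f, OF D mono] unfolding \<Phi> fm by (simp add: f_def)
qed

lemma parallel_self_energy_asymp:
  "(\<lambda>m. 2 * (\<Sum>j=1..<m. parallel_self_energy m j) + parallel_self_energy m m) \<longlonglongrightarrow> ln 2 / 3"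
proof (rule tendsto_sandwich)
  define \<Phi> where "\<Phi> m = ln ((1 + 8 * real m ^ 2) / (1 + 4 * real m ^ 2)) / 8" for m :: nat
  define q where "q m j = real j / (1 + 8 * real m ^ 2 - 4 * real j ^ 2)" for m j :: nat
  let ?D = "\<lambda>m. 1 + 4 * real m ^ 2"
  have qm: "q m m = real m / ?D m" for m by (simp add: q_def add.commute)
  have split: "2 * (\<Sum>j=1..<m. f j) + f m = 2 * (\<Sum>j=1..m. f j) - f m" if "m \<ge> 1" for f :: "nat \<Rightarrow> real" and m
    using that by (simp add: sum.last_plus)
  show "\<forall>\<^sub>F m in sequentially. 2 * (4 / 3 * \<Phi> m - real m / ?D m) - 4 / 3 * (real m / ?D m)
      \<le> 2 * (\<Sum>j=1..<m. parallel_self_energy m j) + parallel_self_energy m m"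
    using eventually_ge_at_top[of 1]
  proof eventually_elim
    case (elim m)
    have "4 / 3 * \<Phi> m - real m / ?D m \<le> 4 / 3 * (\<Sum>j=1..m. q m j) - real m / ?D m"
      unfolding \<Phi>_def q_def using profile_sum_bounds(1)[of m] by simp
    also have "\<dots> = (\<Sum>j=1..m. 4 / 3 * q m j - 1 / ?D m)"
      by (simp add: sum_subtractf sum_distrib_left)
    also have "\<dots> \<le> (\<Sum>j=1..m. parallel_self_energy m j)"
      unfolding q_def by (intro sum_mono self_energy_near_profile) auto
    finally have "4 / 3 * \<Phi> m - real m / ?D m \<le> (\<Sum>j=1..m. parallel_self_energy m j)" .
    moreover have "parallel_self_energy m m \<le> 4 / 3 * q m m"
      unfolding q_def using elim by (intro self_energy_near_profile) auto
    moreover have "2 * (4 / 3 * \<phi> - r) - 4 / 3 * r \<le> 2 * S - e"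
      if "4 / 3 * \<phi> - r \<le> S" "e \<le> 4 / 3 * r" for \<phi> r S e :: real
      by (intro diff_mono mult_left_mono that) simp
    ultimately show ?case unfolding split[OF elim] qm by blast
  qed
  show "\<forall>\<^sub>F m in sequentially. 2 * (\<Sum>j=1..<m. parallel_self_energy m j) + parallel_self_energy m m
      \<le> 2 * (4 / 3 * (\<Phi> m + real m / ?D m)) - 4 / 3 * (real m / ?D m) + 1 / ?D m"
    using eventually_ge_at_top[of 1]
  proof eventually_elim
    case (elim m)
    have "(\<Sum>j=1..m. parallel_self_energy m j) \<le> (\<Sum>j=1..m. 4 / 3 * q m j)"
      unfolding q_def by (intro sum_mono self_energy_near_profile) auto
    also have "\<dots> \<le> 4 / 3 * (\<Phi> m + real m / ?D m)"
      unfolding \<Phi>_def q_def sum_distrib_left[symmetric] using profile_sum_bounds(2)[of m] by simp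
    finally have "(\<Sum>j=1..m. parallel_self_energy m j) \<le> 4 / 3 * (\<Phi> m + real m / ?D m)" .
    moreover have "4 / 3 * q m m - 1 / ?D m \<le> parallel_self_energy m m"
      unfolding q_def using elim by (intro self_energy_near_profile) auto
    moreover have "2 * S - e \<le> 2 * (4 / 3 * (\<phi> + r)) - 4 / 3 * r + d"
      if "S \<le> 4 / 3 * (\<phi> + r)" "4 / 3 * r - d \<le> e" for \<phi> r S d e :: real
      using that by linarith
    ultimately show ?case unfolding split[OF elim] qm by blast
  qed
  show "(\<lambda>m. 2 * (4 / 3 * \<Phi> m - real m / ?D m) - 4 / 3 * (real m / ?D m)) \<longlonglongrightarrow> ln 2 / 3"
    unfolding \<Phi>_def by real_asymp
  show "(\<lambda>m. 2 * (4 / 3 * (\<Phi> m + real m / ?D m)) - 4 / 3 * (real m / ?D m) + 1 / ?D m) \<longlonglongrightarrow> ln 2 / 3"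
    unfolding \<Phi>_def by real_asymp
qed

text \<open>
  With \<open>D = 1 + 4 * m\<^sup>2\<close> and \<open>N = D + 1\<close> the energy is \<open>D\<^sup>2 * s + 2 * D\<^sup>2 * p + 1 / 2 + 4 * D * (same_side_sum m + opposite_side_sum m)\<close>.
  Dividing by \<open>N\<^sup>2\<close> leaves the limits of the four parts and the logarithm \<open>ln m / 2\<close> from \<open>same_side_sum\<close>;
  since \<open>N\<close> is close to \<open>4 * m\<^sup>2\<close>, trading it for \<open>ln N / 4\<close> costs the constant \<open>- ln 2 / 2\<close>.
\<close>
lemma sum_all_ring_pairs_asymp:
  defines "E \<equiv> \<lambda>m. \<Sum>i=0..2*m. \<Sum>j=0..2*m. ring_pair_energy m i j"
  shows "(\<lambda>m. E m / real (diamond_N m) ^ 2 - ln (real (diamond_N m)) / 4) \<longlonglongrightarrow> diamond_const"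
proof -
  define s where "s m = 2 * (\<Sum>j=1..<m. parallel_self_energy m j) + parallel_self_energy m m" for m
  define p where "p m = 2 * (\<Sum>j=1..<m. pole_parallel_energy m j) + pole_parallel_energy m m" for m
  define a where "a m = same_side_sum m / real m ^ 2 - ln (real m) / 2" for m
  define b where "b m = opposite_side_sum m / real m ^ 2" for m
  define N where "N m = 4 * real m ^ 2 + 2" for m :: nat
  define D where "D m = 1 + 4 * real m ^ 2" for m :: nat
  have N: "real (diamond_N m) = N m" "N m > 0" for m by (auto simp: diamond_N_def N_def add_nonneg_pos)
  have lim: "s \<longlonglongrightarrow> ln 2 / 3" "p \<longlonglongrightarrow> 0" "a \<longlonglongrightarrow> - 1 / 4 + (euler_mascheroni - ln 2) / 2" "b \<longlonglongrightarrow> ln 2 / 2"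
    unfolding s_def p_def a_def b_def
    by (rule parallel_self_energy_asymp pole_parallel_energy_asymp same_side_sum_asymp opposite_side_sum_asymp)+
  have w1: "(\<lambda>m. D m ^ 2 / N m ^ 2) \<longlonglongrightarrow> 1" unfolding D_def N_def by real_asymp
  have w2: "(\<lambda>m. 4 * D m * real m ^ 2 / N m ^ 2) \<longlonglongrightarrow> 1" unfolding D_def N_def by real_asymp
  have w3: "(\<lambda>m. 1 / (2 * N m ^ 2)) \<longlonglongrightarrow> 0" unfolding N_def by real_asymp
  have w4: "(\<lambda>m. 4 * D m * real m ^ 2 / N m ^ 2 * (ln (real m) / 2) - ln (N m) / 4) \<longlonglongrightarrow> - (ln 4 / 4)"
    unfolding D_def N_def by real_asymp
  have ln4: "ln (4 :: real) = 2 * ln 2" using ln_realpow[of 2 2] by simp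
  have "(\<lambda>m. D m ^ 2 / N m ^ 2 * s m + 2 * (D m ^ 2 / N m ^ 2) * p m + 1 / (2 * N m ^ 2)
          + 4 * D m * real m ^ 2 / N m ^ 2 * (a m + b m)
          + (4 * D m * real m ^ 2 / N m ^ 2 * (ln (real m) / 2) - ln (N m) / 4))
      \<longlonglongrightarrow> 1 * (ln 2 / 3) + 2 * 1 * 0 + 0 + 1 * (- 1 / 4 + (euler_mascheroni - ln 2) / 2 + ln 2 / 2) + - (ln 4 / 4)"
    by (intro tendsto_add tendsto_mult tendsto_const lim w1 w2 w3 w4)
  also have "1 * (ln 2 / 3) + 2 * 1 * 0 + 0 + 1 * (- 1 / 4 + (euler_mascheroni - ln 2) / 2 + ln 2 / 2) + - (ln 4 / 4) = diamond_const"
    by (simp add: diamond_const_def ln4 field_simps)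
  finally show ?thesis
  proof (rule Lim_transform_eventually)
    show "\<forall>\<^sub>F m in sequentially. D m ^ 2 / N m ^ 2 * s m + 2 * (D m ^ 2 / N m ^ 2) * p m + 1 / (2 * N m ^ 2)
          + 4 * D m * real m ^ 2 / N m ^ 2 * (a m + b m)
          + (4 * D m * real m ^ 2 / N m ^ 2 * (ln (real m) / 2) - ln (N m) / 4)
        = E m / real (diamond_N m) ^ 2 - ln (real (diamond_N m)) / 4"
      using eventually_ge_at_top[of 1]
    proof eventually_elim
      case (elim m)
      have "4 * D m * real m ^ 2 / N m ^ 2 * (a m + b m) + 4 * D m * real m ^ 2 / N m ^ 2 * (ln (real m) / 2)
          = 4 * D m / N m ^ 2 * (real m ^ 2 * (a m + b m + ln (real m) / 2))"
        by (simp add: algebra_simps add_divide_distrib)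
      also have "real m ^ 2 * (a m + b m + ln (real m) / 2) = same_side_sum m + opposite_side_sum m"
        using elim by (simp add: a_def b_def field_simps)
      finally have ab: "4 * D m * real m ^ 2 / N m ^ 2 * (a m + b m) + 4 * D m * real m ^ 2 / N m ^ 2 * (ln (real m) / 2)
          = 4 * D m / N m ^ 2 * (same_side_sum m + opposite_side_sum m)" .
      have "E m / N m ^ 2 = D m ^ 2 / N m ^ 2 * s m + 2 * (D m ^ 2 / N m ^ 2) * p m + 1 / (2 * N m ^ 2)
          + 4 * D m / N m ^ 2 * (same_side_sum m + opposite_side_sum m)"
      proof -
        have "E m = D m ^ 2 * s m + 2 * D m ^ 2 * p m + 1 / 2 + 4 * D m * (same_side_sum m + opposite_side_sum m)"
          unfolding E_def D_def s_def p_def by (rule sum_all_ring_pairs[OF elim])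
        then show ?thesis by (simp add: add_divide_distrib)
      qed
      then show ?case using ab unfolding N by linarith
    qed
  qed
qed

theorem theorem1p2:
  fixes P :: "nat \<Rightarrow> 'a measure"
    and \<theta> :: "nat \<Rightarrow> nat \<Rightarrow> 'a \<Rightarrow> real"
  assumes "\<And>M. M \<ge> 1 \<Longrightarrow> prob_space (P M)"
    and "\<And>M. M \<ge> 1 \<Longrightarrow>
           prob_space.indep_vars (P M) (\<lambda>_. borel) (\<theta> M) {1..2 * M - 1}"
    and "\<And>M j. M \<ge> 1 \<Longrightarrow> j \<in> {1..2 * M - 1} \<Longrightarrow>
           distr (P M) borel (\<theta> M j) = uniform_measure lborel {0..2 * pi}"
  shows "(\<forall>M\<ge>1. \<forall>\<omega>\<in>space (P M).
            diamond_ensemble M (\<lambda>j. \<theta> M j \<omega>) \<subseteq> sphere 0 1 \<and>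
            finite (diamond_ensemble M (\<lambda>j. \<theta> M j \<omega>)) \<and>
            card (diamond_ensemble M (\<lambda>j. \<theta> M j \<omega>)) = diamond_N M) \<and>
         (\<forall>M\<ge>1. integrable (P M) (\<lambda>\<omega>. riesz_2_energy (diamond_ensemble M (\<lambda>j. \<theta> M j \<omega>)))) \<and>
         (\<lambda>M. (LINT \<omega>|P M. riesz_2_energy (diamond_ensemble M (\<lambda>j. \<theta> M j \<omega>)))
              - (1 / 4 * real (diamond_N M) ^ 2 * ln (real (diamond_N M))
                 + diamond_const * real (diamond_N M) ^ 2))
           \<in> o[at_top](\<lambda>M. real (diamond_N M) ^ 2) \<and>
         - 0.0770 < diamond_const \<and> diamond_const \<le> - 0.0769"
proof (intro conjI)
  show "\<forall>M\<ge>1. \<forall>\<omega>\<in>space (P M).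
            diamond_ensemble M (\<lambda>j. \<theta> M j \<omega>) \<subseteq> sphere 0 1 \<and>
            finite (diamond_ensemble M (\<lambda>j. \<theta> M j \<omega>)) \<and>
            card (diamond_ensemble M (\<lambda>j. \<theta> M j \<omega>)) = diamond_N M"
    using diamond_ensemble_subset_sphere diamond_ensemble_card by blast
  show "\<forall>M\<ge>1. integrable (P M) (\<lambda>\<omega>. riesz_2_energy (diamond_ensemble M (\<lambda>j. \<theta> M j \<omega>)))"
    using prob_space.expected_riesz_2_energy(1)[OF assms(1)] assms(2,3) by blast
  define E where "E m = (\<Sum>i=0..2*m. \<Sum>j=0..2*m. ring_pair_energy m i j)" for m
  have E: "(LINT \<omega>|P M. riesz_2_energy (diamond_ensemble M (\<lambda>j. \<theta> M j \<omega>))) = E M" if "M \<ge> 1" for M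
    unfolding E_def using prob_space.expected_riesz_2_energy(2)[OF assms(1)[OF that] that] assms(2,3) that by blast
  have N: "real (diamond_N M) > 0" for M by (simp add: diamond_N_def add_pos_nonneg)
  show "(\<lambda>M. (LINT \<omega>|P M. riesz_2_energy (diamond_ensemble M (\<lambda>j. \<theta> M j \<omega>)))
              - (1 / 4 * real (diamond_N M) ^ 2 * ln (real (diamond_N M))
                 + diamond_const * real (diamond_N M) ^ 2))
           \<in> o[at_top](\<lambda>M. real (diamond_N M) ^ 2)"
  proof (rule smalloI_tendsto)
    have "(\<lambda>M. E M / real (diamond_N M) ^ 2 - ln (real (diamond_N M)) / 4 - diamond_const) \<longlonglongrightarrow> diamond_const - diamond_const"
      unfolding E_def by (intro tendsto_diff sum_all_ring_pairs_asymp tendsto_const)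
    then have "(\<lambda>M. E M / real (diamond_N M) ^ 2 - ln (real (diamond_N M)) / 4 - diamond_const) \<longlonglongrightarrow> 0" by simp
    then show "(\<lambda>M. ((LINT \<omega>|P M. riesz_2_energy (diamond_ensemble M (\<lambda>j. \<theta> M j \<omega>)))
              - (1 / 4 * real (diamond_N M) ^ 2 * ln (real (diamond_N M))
                 + diamond_const * real (diamond_N M) ^ 2)) / real (diamond_N M) ^ 2) \<longlonglongrightarrow> 0"
    proof (rule Lim_transform_eventually)
      show "\<forall>\<^sub>F M in sequentially. E M / real (diamond_N M) ^ 2 - ln (real (diamond_N M)) / 4 - diamond_const =
          ((LINT \<omega>|P M. riesz_2_energy (diamond_ensemble M (\<lambda>j. \<theta> M j \<omega>)))
              - (1 / 4 * real (diamond_N M) ^ 2 * ln (real (diamond_N M))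
                 + diamond_const * real (diamond_N M) ^ 2)) / real (diamond_N M) ^ 2"
        using eventually_ge_at_top[of 1]
      proof eventually_elim
        case (elim M)
        show ?case unfolding E[OF elim] using N[of M] by (simp add: field_simps)
      qed
    qed
    show "\<forall>\<^sub>F M in sequentially. real (diamond_N M) ^ 2 \<noteq> 0"
      using N by (intro always_eventually allI) (simp add: less_imp_neq[symmetric])
  qed
  show "- 0.0770 < diamond_const" "diamond_const \<le> - 0.0769" by (rule diamond_const_bounds)+
qed

end
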